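(* Let $p$ be a prime and let $X$ be a simply-connected $p$-local CW-complex whose homology groups are finitely generated over $\mathbb{Z}_p$ in each dimension. Then $N_\ast\mathcal{E}(X)=N_\ast\mathcal{E}(X;p)$.
   Context: $\mathbb{Z}_p$ denotes the integers localized at $p$ and $\mathbb{Z}/p$ the integers modulo $p$. $[X,X]$ is the set of based homotopy classes of based self-maps and $\mathcal{E}(X)\subseteq[X,X]$ the group of self-homotopy equivalences; homology is reduced and $H_i(X)=H_i(X;\mathbb{Z})$. $\mathcal{A}_\ast^k(X)=\{f\in[X,X]: f_\ast\colon H_i(X)\to H_i(X)\text{ is an isomorphism for all } i\leq k\}$ and $\mathcal{A}_\ast^k(X;p)=\{f\in[X,X]: f_\ast\colon H_i(X;\mathbb{Z}/p)\to H_i(X;\mathbb{Z}/p)\text{ is an isomorphism for all } i\leq k\}$. The homology and mod-$p$ homology self-closeness numbers are $N_\ast\mathcal{E}(X)=\min\{k\geq 0:\mathcal{A}_\ast^k(X)=\mathcal{E}(X)\}$ and $N_\ast\mathcal{E}(X;p)=\min\{k\geq 0:\mathcal{A}_\ast^k(X;p)=\mathcal{E}(X)\}$ ($+\infty$ if there is no such $k$). *)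

theory Defs
  imports
    "HOL-Homology.Homology"
    "HOL-Algebra.Module"
    "HOL-Computational_Algebra.Primes"
    "HOL-Library.Extended_Nat"
begin

section \<open>CW complexes\<close>

definition disk :: "nat \<Rightarrow> (nat \<Rightarrow> real) topology" where
  "disk n = subtopology (Euclidean_space n) {x. (\<Sum>i<n. (x i)\<^sup>2) \<le> 1}"

definition open_disk :: "nat \<Rightarrow> (nat \<Rightarrow> real) set" where
  "open_disk n = {x \<in> topspace (disk n). (\<Sum>i<n. (x i)\<^sup>2) < 1}"

text \<open>A cell is a pair of its dimension and its characteristic map. For \<open>n = 0\<close> the disk and the
  open disk are both the one-point space. In the weak topology condition the closed set
  \<open>\<Phi> ` topspace (disk n)\<close> is the closure of the cell.\<close>

definition CW_structure :: "'a topology \<Rightarrow> (nat \<times> ((nat \<Rightarrow> real) \<Rightarrow> 'a)) set \<Rightarrow> bool" where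
  "CW_structure X \<C> \<longleftrightarrow>
     Hausdorff_space X \<and>
     (\<forall>(n, \<Phi>) \<in> \<C>. continuous_map (disk n) X \<Phi> \<and>
        embedding_map (subtopology (disk n) (open_disk n)) X \<Phi>) \<and>
     disjoint_family_on (\<lambda>(n, \<Phi>). \<Phi> ` open_disk n) \<C> \<and>
     (\<Union>(n, \<Phi>) \<in> \<C>. \<Phi> ` open_disk n) = topspace X \<and>
     (\<forall>(n, \<Phi>) \<in> \<C>. \<exists>\<F>. finite \<F> \<and> \<F> \<subseteq> {(m, \<Psi>) \<in> \<C>. m < n} \<and>
        \<Phi> ` (topspace (disk n) - open_disk n) \<subseteq> (\<Union>(m, \<Psi>) \<in> \<F>. \<Psi> ` open_disk m)) \<and>
     (\<forall>A \<subseteq> topspace X. (\<forall>(n, \<Phi>) \<in> \<C>. closedin X (A \<inter> \<Phi> ` topspace (disk n))) \<longrightarrow> closedin X A)"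

definition CW_complex :: "'a topology \<Rightarrow> bool" where
  "CW_complex X \<longleftrightarrow> (\<exists>\<C>. CW_structure X \<C>)"


section \<open>Homotopy groups, simple connectivity, \<open>p\<close>-local spaces\<close>

definition cube :: "nat \<Rightarrow> (nat \<Rightarrow> real) topology" where
  "cube n = product_topology (\<lambda>i. top_of_set {0..1}) {..<n}"

definition cube_boundary :: "nat \<Rightarrow> (nat \<Rightarrow> real) set" where
  "cube_boundary n = {t \<in> topspace (cube n). \<exists>i<n. t i = 0 \<or> t i = 1}"

definition spheroids :: "nat \<Rightarrow> 'a topology \<Rightarrow> 'a \<Rightarrow> ((nat \<Rightarrow> real) \<Rightarrow> 'a) set" where
  "spheroids n X x = {f. continuous_map (cube n) X f \<and> (\<forall>t \<in> cube_boundary n. f t = x)}"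

definition spheroid_homotopy ::
    "nat \<Rightarrow> 'a topology \<Rightarrow> 'a \<Rightarrow> (((nat \<Rightarrow> real) \<Rightarrow> 'a) \<times> ((nat \<Rightarrow> real) \<Rightarrow> 'a)) set" where
  "spheroid_homotopy n X x =
     {(f, g). homotopic_with (\<lambda>h. \<forall>t \<in> cube_boundary n. h t = x) (cube n) X f g}"

definition spheroid_concat ::
    "((nat \<Rightarrow> real) \<Rightarrow> 'a) \<Rightarrow> ((nat \<Rightarrow> real) \<Rightarrow> 'a) \<Rightarrow> (nat \<Rightarrow> real) \<Rightarrow> 'a" where
  "spheroid_concat f g = (\<lambda>t. if t 0 \<le> 1/2 then f (t(0 := 2 * t 0)) else g (t(0 := 2 * t 0 - 1)))"

text \<open>The group \<open>\<pi>\<^sub>n(X, x)\<close>, written multiplicatively; meaningful for \<open>n \<ge> 1\<close> only.\<close>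

definition homotopy_group ::
    "nat \<Rightarrow> 'a topology \<Rightarrow> 'a \<Rightarrow> ((nat \<Rightarrow> real) \<Rightarrow> 'a) set monoid" where
  "homotopy_group n X x =
     \<lparr>carrier = spheroids n X x // spheroid_homotopy n X x,
      monoid.mult = (\<lambda>A B. \<Union>f \<in> A. \<Union>g \<in> B. spheroid_homotopy n X x `` {spheroid_concat f g}),
      one = spheroid_homotopy n X x `` {\<lambda>_. x}\<rparr>"

definition simply_connected_space :: "'a topology \<Rightarrow> bool" where
  "simply_connected_space X \<longleftrightarrow>
     topspace X \<noteq> {} \<and> path_connected_space X \<and>
     (\<forall>x \<in> topspace X. carrier (homotopy_group 1 X x) = {\<one>\<^bsub>homotopy_group 1 X x\<^esub>})"

definition p_local_group :: "nat \<Rightarrow> ('a, 'b) monoid_scheme \<Rightarrow> bool" where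
  "p_local_group p G \<longleftrightarrow>
     (\<forall>m::nat. coprime m p \<longrightarrow> bij_betw (\<lambda>g. g [^]\<^bsub>G\<^esub> m) (carrier G) (carrier G))"

text \<open>The usual definition of \<open>p\<close>-locality for simply connected (more generally nilpotent) spaces.\<close>

definition p_local_space :: "nat \<Rightarrow> 'a topology \<Rightarrow> bool" where
  "p_local_space p X \<longleftrightarrow>
     (\<forall>x \<in> topspace X. \<forall>n \<ge> 1. p_local_group p (homotopy_group n X x))"


section \<open>Finite generation over the integers localized at \<open>p\<close>\<close>

definition Z_loc :: "nat \<Rightarrow> rat ring" where
  "Z_loc p = \<lparr>carrier = {r. \<exists>a b::int. \<not> int p dvd b \<and> r = of_int a / of_int b},
     monoid.mult = (*), one = 1, zero = 0, add = (+)\<rparr>"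

lemma cring_Z_loc:
  assumes "prime p"
  shows "cring (Z_loc p)"
proof -
  have pr: "prime (int p)" using assms by simp
  have frac: "of_int a / of_int b \<in> carrier (Z_loc p)" if "\<not> int p dvd b" for a b
    using that by (auto simp: Z_loc_def)
  have add: "x + y \<in> carrier (Z_loc p)" and mult: "x * y \<in> carrier (Z_loc p)"
    if xy: "x \<in> carrier (Z_loc p)" "y \<in> carrier (Z_loc p)" for x y
  proof -
    obtain a b c d where *: "\<not> int p dvd b" "x = of_int a / of_int b"
        "\<not> int p dvd d" "y = of_int c / of_int d"
      using xy by (auto simp: Z_loc_def)
    then have nz: "b \<noteq> 0" "d \<noteq> 0" by auto
    have bd: "\<not> int p dvd b * d" using * pr by (simp add: prime_dvd_mult_iff)
    have "x + y = of_int (a * d + c * b) / of_int (b * d)"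
      using * nz by (simp add: add_frac_eq mult.commute)
    then show "x + y \<in> carrier (Z_loc p)" using bd frac by metis
    have "x * y = of_int (a * c) / of_int (b * d)" using * by simp
    then show "x * y \<in> carrier (Z_loc p)" using bd frac by metis
  qed
  have int: "of_int k \<in> carrier (Z_loc p)" for k
    using frac[of 1 k] assms not_prime_1 by (cases "p = 1") auto
  have neg: "- x \<in> carrier (Z_loc p)" if "x \<in> carrier (Z_loc p)" for x
    using mult[OF int[of "-1"] that] by simp
  have zero: "0 \<in> carrier (Z_loc p)" and one: "1 \<in> carrier (Z_loc p)"
    using int[of 0] int[of 1] by auto
  have [simp]: "(\<oplus>\<^bsub>Z_loc p\<^esub>) = (+)" "(\<otimes>\<^bsub>Z_loc p\<^esub>) = (*)" "\<zero>\<^bsub>Z_loc p\<^esub> = 0" "\<one>\<^bsub>Z_loc p\<^esub> = 1"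
    by (simp_all add: Z_loc_def)
  show ?thesis
  proof (rule cringI)
    show "abelian_group (Z_loc p)"
    proof (rule abelian_groupI)
      show "\<exists>y\<in>carrier (Z_loc p). y \<oplus>\<^bsub>Z_loc p\<^esub> x = \<zero>\<^bsub>Z_loc p\<^esub>"
        if "x \<in> carrier (Z_loc p)" for x
        using neg[OF that] by (intro bexI[of _ "- x"]) simp_all
    qed (simp_all add: add zero)
    show "Group.comm_monoid (Z_loc p)"
      by (rule comm_monoidI) (simp_all add: mult one)
  qed (simp add: distrib_right)
qed

text \<open>A multiplicatively written group with a scalar action, in the module record format; the
  fields \<open>mult\<close> and \<open>one\<close> play no role in a module.\<close>

definition module_of :: "('a, 'b) monoid_scheme \<Rightarrow> ('r \<Rightarrow> 'a \<Rightarrow> 'a) \<Rightarrow> ('r, 'a) module" where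
  "module_of G act = \<lparr>carrier = carrier G, monoid.mult = undefined, one = undefined,
     zero = \<one>\<^bsub>G\<^esub>, add = (\<otimes>\<^bsub>G\<^esub>), smult = act\<rparr>"

definition fin_gen_module :: "('r, 'c) ring_scheme \<Rightarrow> ('r, 'a) module \<Rightarrow> bool" where
  "fin_gen_module R M \<longleftrightarrow> module R M \<and>
     (\<exists>S. finite S \<and> S \<subseteq> carrier M \<and>
        (\<forall>x \<in> carrier M. \<exists>c \<in> S \<rightarrow> carrier R. x = finsum M (\<lambda>s. c s \<odot>\<^bsub>M\<^esub> s) S))"

text \<open>A module structure over \<open>Z_loc p\<close> on an abelian group is unique if it exists.\<close>

definition fin_gen_over_Z_loc :: "nat \<Rightarrow> ('a, 'b) monoid_scheme \<Rightarrow> bool" where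
  "fin_gen_over_Z_loc p G \<longleftrightarrow> (\<exists>act. fin_gen_module (Z_loc p) (module_of G act))"


section \<open>Singular homology with coefficients in \<open>\<int>/m\<close>\<close>

text \<open>The homology of \<open>C \<otimes> \<int>/m = C / mC\<close> for the singular chain complex \<open>C\<close> of \<open>X\<close>. As the library
  does for the quotient complex of a pair of spaces, cycles and boundaries of \<open>C / mC\<close> are
  represented by their preimages in \<open>C\<close>.\<close>

definition chain_multiples :: "nat \<Rightarrow> nat \<Rightarrow> 'a topology \<Rightarrow> 'a chain set" where
  "chain_multiples m i X = frag_cmul (int m) ` singular_chain_set i X"

definition mod_cycles :: "nat \<Rightarrow> nat \<Rightarrow> 'a topology \<Rightarrow> 'a chain set" where
  "mod_cycles m i X =
     {c. singular_chain i X c \<and> chain_boundary i c \<in> chain_multiples m (i - 1) X}"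

definition mod_boundaries :: "nat \<Rightarrow> nat \<Rightarrow> 'a topology \<Rightarrow> 'a chain set" where
  "mod_boundaries m i X =
     {chain_boundary (Suc i) d + e | d e. singular_chain (Suc i) X d \<and> e \<in> chain_multiples m i X}"

definition mod_homology_group :: "nat \<Rightarrow> nat \<Rightarrow> 'a topology \<Rightarrow> 'a chain set monoid" where
  "mod_homology_group m i X =
     subgroup_generated (chain_group i X) (mod_cycles m i X) Mod mod_boundaries m i X"

definition mod_hom_induced ::
    "nat \<Rightarrow> nat \<Rightarrow> 'a topology \<Rightarrow> 'b topology \<Rightarrow> ('a \<Rightarrow> 'b) \<Rightarrow> 'a chain set \<Rightarrow> 'b chain set" where
  "mod_hom_induced m i X Y f A = {chain_map i f c + b | c b. c \<in> A \<and> b \<in> mod_boundaries m i Y}"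

definition reduced_mod_homology_group :: "nat \<Rightarrow> nat \<Rightarrow> 'a topology \<Rightarrow> 'a chain set monoid" where
  "reduced_mod_homology_group m i X =
     subgroup_generated (mod_homology_group m i X)
       (kernel (mod_homology_group m i X) (mod_homology_group m i (discrete_topology {()}))
          (mod_hom_induced m i X (discrete_topology {()}) (\<lambda>x. ())))"

lemma chain_multiples_imp_chain: "c \<in> chain_multiples m i X \<Longrightarrow> singular_chain i X c"
  by (auto simp: chain_multiples_def singular_chain_cmul)

lemma zero_chain_multiples: "0 \<in> chain_multiples m i X"
  unfolding chain_multiples_def by (rule image_eqI[of _ _ 0]) auto

lemma add_chain_multiples:
  "\<lbrakk>a \<in> chain_multiples m i X; b \<in> chain_multiples m i X\<rbrakk> \<Longrightarrow> a + b \<in> chain_multiples m i X"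
  unfolding chain_multiples_def
proof (elim imageE)
  fix c d assume cd: "a = frag_cmul (int m) c" "c \<in> singular_chain_set i X"
    "b = frag_cmul (int m) d" "d \<in> singular_chain_set i X"
  show "a + b \<in> frag_cmul (int m) ` singular_chain_set i X"
    by (rule image_eqI[of _ _ "c + d"])
      (use cd in \<open>auto simp: frag_cmul_distrib2 singular_chain_add\<close>)
qed

lemma minus_chain_multiples: "a \<in> chain_multiples m i X \<Longrightarrow> - a \<in> chain_multiples m i X"
  unfolding chain_multiples_def
proof (elim imageE)
  fix c assume c: "a = frag_cmul (int m) c" "c \<in> singular_chain_set i X"
  show "- a \<in> frag_cmul (int m) ` singular_chain_set i X"
    by (rule image_eqI[of _ _ "- c"])
      (use c in \<open>auto simp: singular_chain_minus intro: poly_mapping_eqI\<close>)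
qed

lemma boundary_chain_multiples:
  "a \<in> chain_multiples m i X \<Longrightarrow> chain_boundary i a \<in> chain_multiples m (i - 1) X"
  by (auto simp: chain_multiples_def chain_boundary_cmul singular_chain_boundary)

lemma chain_map_chain_multiples:
  "\<lbrakk>a \<in> chain_multiples m i X; continuous_map X Y f\<rbrakk> \<Longrightarrow> chain_map i f a \<in> chain_multiples m i Y"
  by (auto simp: chain_multiples_def chain_map_cmul singular_chain_chain_map)

lemma subgroup_mod_cycles: "subgroup (mod_cycles m i X) (chain_group i X)"
proof
  show "inv\<^bsub>chain_group i X\<^esub> x \<in> mod_cycles m i X" if "x \<in> mod_cycles m i X" for x
    using that
    by (auto simp: mod_cycles_def chain_boundary_minus minus_chain_multiples singular_chain_minus
        singular_chain_def)
qed (auto simp: mod_cycles_def chain_boundary_add singular_chain_add add_chain_multiples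
    zero_chain_multiples)

lemma mod_boundaries_subset_cycles: "mod_boundaries m i X \<subseteq> mod_cycles m i X"
proof
  fix x assume "x \<in> mod_boundaries m i X"
  then obtain d e where x: "x = chain_boundary (Suc i) d + e" "singular_chain (Suc i) X d"
      "e \<in> chain_multiples m i X"
    by (auto simp: mod_boundaries_def)
  have "chain_boundary i x = chain_boundary i e"
    using x by (simp add: chain_boundary_add chain_boundary_boundary_alt)
  then show "x \<in> mod_cycles m i X"
    using x boundary_chain_multiples[of e m i X]
    by (simp add: mod_cycles_def singular_chain_add singular_chain_boundary_alt
        chain_multiples_imp_chain)
qed

lemma subgroup_mod_boundaries: "subgroup (mod_boundaries m i X) (chain_group i X)"
proof
  show sub: "mod_boundaries m i X \<subseteq> carrier (chain_group i X)"
    using mod_boundaries_subset_cycles by (fastforce simp: mod_cycles_def)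
  fix x assume x: "x \<in> mod_boundaries m i X"
  then obtain d e where de: "x = chain_boundary (Suc i) d + e" "singular_chain (Suc i) X d"
      "e \<in> chain_multiples m i X"
    by (auto simp: mod_boundaries_def)
  have "- x = chain_boundary (Suc i) (- d) + - e"
    by (simp add: de chain_boundary_minus)
  then have "- x \<in> mod_boundaries m i X"
    using de unfolding mod_boundaries_def
    by (blast intro: minus_chain_multiples singular_chain_minus[THEN iffD2])
  then show "inv\<^bsub>chain_group i X\<^esub> x \<in> mod_boundaries m i X"
    using sub x by (auto simp: singular_chain_def)
  fix y assume "y \<in> mod_boundaries m i X"
  then obtain d' e' where de': "y = chain_boundary (Suc i) d' + e'" "singular_chain (Suc i) X d'"
      "e' \<in> chain_multiples m i X"
    by (auto simp: mod_boundaries_def)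
  have "x + y = chain_boundary (Suc i) (d + d') + (e + e')"
    by (simp add: de de' chain_boundary_add)
  moreover have "singular_chain (Suc i) X (d + d')" "e + e' \<in> chain_multiples m i X"
    using de de' by (auto intro: singular_chain_add add_chain_multiples)
  ultimately show "x \<otimes>\<^bsub>chain_group i X\<^esub> y \<in> mod_boundaries m i X"
    unfolding mod_boundaries_def mult_chain_group by blast
next
  show "\<one>\<^bsub>chain_group i X\<^esub> \<in> mod_boundaries m i X"
    unfolding mod_boundaries_def
    by (auto intro!: exI[of _ 0] zero_chain_multiples)
qed

lemma normal_mod_boundaries:
  "mod_boundaries m i X \<lhd> subgroup_generated (chain_group i X) (mod_cycles m i X)"
  by (meson abelian_chain_group comm_group.normal_iff_subgroup group.abelian_subgroup_generated
      group.subgroup_of_subgroup_generated group_chain_group mod_boundaries_subset_cycles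
      subgroup_mod_boundaries)

lemma group_mod_homology_group: "group (mod_homology_group m i X)"
  by (simp add: mod_homology_group_def normal.factorgroup_is_group normal_mod_boundaries)

text \<open>On the class of a cycle \<open>c\<close> the induced map is the class of \<open>chain_map i f c\<close>.\<close>

lemma mod_hom_induced_class:
  assumes f: "continuous_map X Y f"
  shows "mod_hom_induced m i X Y f {c + b | b. b \<in> mod_boundaries m i X} =
         {chain_map i f c + b | b. b \<in> mod_boundaries m i Y}"
proof -
  have "chain_map i f b \<in> mod_boundaries m i Y" if "b \<in> mod_boundaries m i X" for b
  proof -
    obtain d e where de: "b = chain_boundary (Suc i) d + e" "singular_chain (Suc i) X d"
        "e \<in> chain_multiples m i X"
      using \<open>b \<in> _\<close> by (auto simp: mod_boundaries_def)
    have "chain_map i f b = chain_boundary (Suc i) (chain_map (Suc i) f d) + chain_map i f e"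
      using de chain_boundary_chain_map[of "Suc i" X d f] by (simp add: chain_map_add)
    then show ?thesis
      using de f unfolding mod_boundaries_def
      by (blast intro: chain_map_chain_multiples singular_chain_chain_map)
  qed
  then have "chain_map i f (c + b) + b' = chain_map i f c + (chain_map i f b + b') \<and>
      chain_map i f b + b' \<in> mod_boundaries m i Y"
    if "b \<in> mod_boundaries m i X" "b' \<in> mod_boundaries m i Y" for b b'
    using that subgroup.m_closed[OF subgroup_mod_boundaries[where m = m and i = i and X = Y],
        of "chain_map i f b" b']
    by (simp add: chain_map_add add.assoc)
  moreover have "chain_map i f c + b' = chain_map i f (c + 0) + b'" for b'
    by simp
  moreover have "0 \<in> mod_boundaries m i X"
    using subgroup.one_closed[OF subgroup_mod_boundaries[where m = m and i = i and X = X]] by simp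
  ultimately show ?thesis
    unfolding mod_hom_induced_def by blast
qed


section \<open>Self-closeness numbers\<close>

definition based_maps :: "'a topology \<Rightarrow> 'a \<Rightarrow> ('a \<Rightarrow> 'a) set" where
  "based_maps X x0 = {f. continuous_map X X f \<and> f x0 = x0}"

definition based_homotopy :: "'a topology \<Rightarrow> 'a \<Rightarrow> (('a \<Rightarrow> 'a) \<times> ('a \<Rightarrow> 'a)) set" where
  "based_homotopy X x0 = {(f, g). homotopic_with (\<lambda>h. h x0 = x0) X X f g}"

definition based_classes :: "'a topology \<Rightarrow> 'a \<Rightarrow> ('a \<Rightarrow> 'a) set set" where
  "based_classes X x0 = based_maps X x0 // based_homotopy X x0"

definition self_equivalences :: "'a topology \<Rightarrow> 'a \<Rightarrow> ('a \<Rightarrow> 'a) set set" where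
  "self_equivalences X x0 = {F \<in> based_classes X x0. \<exists>f \<in> F. \<exists>g \<in> based_maps X x0.
     (g \<circ> f, id) \<in> based_homotopy X x0 \<and> (f \<circ> g, id) \<in> based_homotopy X x0}"

text \<open>Homotopic maps induce the same homomorphism, so the quantifier over the (nonempty) class \<open>F\<close>
  below amounts to a choice of representative.\<close>

definition homology_iso_classes :: "nat \<Rightarrow> 'a topology \<Rightarrow> 'a \<Rightarrow> ('a \<Rightarrow> 'a) set set" where
  "homology_iso_classes k X x0 = {F \<in> based_classes X x0. \<forall>f \<in> F. \<forall>i \<le> k.
     hom_induced (int i) X {} X {} f
       \<in> iso (reduced_homology_group (int i) X) (reduced_homology_group (int i) X)}"

definition mod_homology_iso_classes ::
    "nat \<Rightarrow> nat \<Rightarrow> 'a topology \<Rightarrow> 'a \<Rightarrow> ('a \<Rightarrow> 'a) set set" where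
  "mod_homology_iso_classes p k X x0 = {F \<in> based_classes X x0. \<forall>f \<in> F. \<forall>i \<le> k.
     mod_hom_induced p i X X f
       \<in> iso (reduced_mod_homology_group p i X) (reduced_mod_homology_group p i X)}"

text \<open>The infimum of the empty set in \<^typ>\<open>enat\<close> is \<open>\<infinity>\<close>.\<close>

definition self_closeness :: "'a topology \<Rightarrow> 'a \<Rightarrow> enat" where
  "self_closeness X x0 =
     (INF k \<in> {k. homology_iso_classes k X x0 = self_equivalences X x0}. enat k)"

definition mod_self_closeness :: "nat \<Rightarrow> 'a topology \<Rightarrow> 'a \<Rightarrow> enat" where
  "mod_self_closeness p X x0 =
     (INF k \<in> {k. mod_homology_iso_classes p k X x0 = self_equivalences X x0}. enat k)"

end

theory Submission
  imports Defs "HOL-Computational_Algebra.Polynomial"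
begin

text \<open>For every \<open>k\<close> the two sets of self-maps agree. In degree \<open>0\<close> both reduced groups vanish. If \<open>f\<close>
  is bijective on \<open>H\<^sub>i\<close> and \<open>H\<^bsub>i-1\<^esub>\<close>, it is bijective on \<open>H\<^sub>i(X; \<int>/p)\<close> by the universal coefficient
  sequence. Conversely, if \<open>f\<close> is injective on \<open>H\<^sub>i(X; \<int>/p)\<close>, then it is injective on
  \<open>H = H\<^sub>i(X)\<close> modulo \<open>p\<close>; as \<open>H / pH\<close> is finite, \<open>H = f H + pH\<close>. Nakayama's lemma gives \<open>H = f H\<close>,
  and a surjective endomorphism of a finitely generated module is injective.\<close>

section \<open>Endomorphisms of finitely generated modules\<close>

text \<open>The integers localized at \<open>p\<close> act on homology but not on chains.
  Denominators are therefore cleared: scalars become integers \<open>u\<close> coprime to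
  \<open>p\<close>, and equality in homology becomes a difference lying in \<open>B\<close>. The
  module structure over the localization turns into the fact that these \<open>u\<close> act
  bijectively on \<open>Z / B\<close>. For the same reason Nakayama's lemma is stated with a
  multiplicative set \<open>V\<close> in place of a local ring: it only puts some multiple
  \<open>v *s m\<close> with \<open>v \<in> V\<close> into \<open>N\<close>, and \<open>v\<close> is
  divided out afterwards. This one form serves both uses, over the integers with
  \<open>i = p\<close> and over integer polynomials with the variable as \<open>i\<close>. Passing
  to coefficients modulo \<open>p\<close> mixes two adjacent degrees, whereas the way back works in
  each degree separately; hence whole ranges \<open>i \<le> k\<close> are compared.\<close>

no_notation vector_scalar_mult (infixl \<open>*s\<close> 70)

context Modules.module
begin

text \<open>Localized at \<open>V\<close>, the element \<open>i\<close> lies in the Jacobson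
  radical, because each \<open>v - i * r\<close> becomes a unit, and the hypothesis puts
  \<open>M\<close> into \<open>N\<close> plus \<open>i\<close> times \<open>span S\<close>. The
  bound is by \<open>span S\<close> and not by \<open>M\<close>, so that the induction can remove
  generators one at a time.\<close>

lemma nakayama_multiplicative:
  assumes "finite S" "S \<subseteq> M" "subspace M" "subspace N" "N \<subseteq> M"
    and V_mult: "\<And>v w. v \<in> V \<Longrightarrow> w \<in> V \<Longrightarrow> v * w \<in> V"
    and V_diff: "\<And>v r. v \<in> V \<Longrightarrow> v - i * r \<in> V"
    and gen: "\<And>m. m \<in> M \<Longrightarrow> \<exists>v\<in>V. \<exists>n\<in>N. \<exists>w\<in>span S. v *s m = n + i *s w"
    and m: "m \<in> M"
  shows "\<exists>v\<in>V. v *s m \<in> N"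
  using assms(1,2,4,5) gen m
proof (induction S arbitrary: N m)
  case empty
  then show ?case by fastforce
next
  case (insert t S)
  \<comment> \<open>Adjoining \<open>t\<close> to \<open>N\<close> absorbs the contribution of
    \<open>t\<close> to \<open>span (insert t S)\<close>, so the remaining generators satisfy the
    hypothesis for \<open>N'\<close>.\<close>
  define N' where "N' = span (insert t N)"
  have spanN: "span N = N"
    using insert.prems by (simp add: span_subspace)
  have N': "x \<in> N' \<longleftrightarrow> (\<exists>k. x - k *s t \<in> N)" for x
    by (simp add: N'_def span_insert spanN)
  have tM: "t \<in> M" using insert.prems by auto
  have "subspace N'" "N' \<subseteq> M"
    unfolding N'_def using span_minimal[of "insert t N" M] insert.prems \<open>subspace M\<close> by auto
  moreover have "\<exists>v\<in>V. \<exists>n\<in>N'. \<exists>w\<in>span S. v *s x = n + i *s w" if "x \<in> M" for x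
  proof -
    obtain v n w where v: "v \<in> V" "n \<in> N" "w \<in> span (insert t S)" "v *s x = n + i *s w"
      using insert.prems(4)[OF \<open>x \<in> M\<close>] by blast
    obtain k where k: "w - k *s t \<in> span S" using v by (auto simp: span_insert)
    have "v *s x = (n + (i * k) *s t) + i *s (w - k *s t)"
      using v by (simp add: algebra_simps)
    moreover have "n + (i * k) *s t \<in> N'"
      unfolding N' using v by (intro exI[of _ "i * k"]) simp
    ultimately show ?thesis using v k by blast
  qed
  ultimately have IH: "\<exists>v\<in>V. v *s x \<in> N'" if "x \<in> M" for x
    using insert.IH[of N' x] insert.prems(1) that by auto
  \<comment> \<open>It remains to push a multiple of \<open>t\<close> itself into \<open>N\<close>,
    so the hypothesis is applied to \<open>t\<close>.\<close>
  obtain u n w where u: "u \<in> V" "n \<in> N" "w \<in> span (insert t S)" "u *s t = n + i *s w"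
    using insert.prems(4)[OF tM] by blast
  have "w \<in> M" using u span_minimal[OF insert.prems(1) \<open>subspace M\<close>] by auto
  then obtain v k where v: "v \<in> V" "v *s w - k *s t \<in> N" using IH N' by meson
  \<comment> \<open>Multiplying \<open>u *s t = n + i *s w\<close> by \<open>v\<close> and replacing
    \<open>v *s w\<close> by \<open>k *s t\<close> modulo \<open>N\<close> shows that this scalar
    annihilates \<open>t\<close> modulo \<open>N\<close>.\<close>
  define z where "z = v * u - i * k"
  have "z \<in> V" using u v by (simp add: z_def V_mult V_diff)
  have "z *s t = v *s (u *s t) - (i * k) *s t" by (simp add: z_def algebra_simps)
  also have "\<dots> = v *s n + i *s (v *s w - k *s t)" unfolding u(4) by (simp add: algebra_simps)
  also have "\<dots> \<in> N" using u v insert.prems by (simp add: subspace_add subspace_scale)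
  finally have zt: "z *s t \<in> N" .
  obtain v' k' where v': "v' \<in> V" "v' *s m - k' *s t \<in> N" using IH[OF \<open>m \<in> M\<close>] N' by meson
  have "(z * v') *s m = z *s (v' *s m - k' *s t) + k' *s (z *s t)"
    by (simp add: algebra_simps)
  also have "\<dots> \<in> N"
    by (intro subspace_add[OF insert.prems(2)] subspace_scale[OF insert.prems(2)] v' zt)
  finally show ?case using \<open>z \<in> V\<close> v' V_mult by blast
qed

end

section \<open>Polynomials acting through an endomorphism of an abelian group\<close>

locale int_module = Modules.module scale
  for scale :: "int \<Rightarrow> 'b::ab_group_add \<Rightarrow> 'b" (infixr \<open>*s\<close> 75)
begin

text \<open>Horner evaluation of \<open>q\<close> at the endomorphism \<open>f\<close>: the action
  of integer polynomials in which the variable acts as \<open>f\<close>.\<close>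

definition poly_scale :: "('b \<Rightarrow> 'b) \<Rightarrow> int poly \<Rightarrow> 'b \<Rightarrow> 'b" where
  "poly_scale f q = fold_coeffs (\<lambda>a g x. a *s x + f (g x)) q (\<lambda>_. 0)"

lemma poly_scale_0 [simp]: "poly_scale f 0 x = 0"
  by (simp add: poly_scale_def)

text \<open>Since \<open>pCons 0 0\<close> is the zero polynomial, the equation itself forces
  \<open>f 0 = 0\<close>.\<close>

lemma poly_scale_pCons:
  assumes "f 0 = 0"
  shows "poly_scale f (pCons a q) x = a *s x + f (poly_scale f q x)"
  using assms by (cases "q = 0"; cases "a = 0") (auto simp: poly_scale_def)

lemma module_poly_scale:
  assumes f_add: "\<And>x y. f (x + y) = f x + f y" and f_scale: "\<And>a x. f (a *s x) = a *s f x"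
  shows "Modules.module (poly_scale f)"
proof -
  have f0: "f 0 = 0" using f_scale[of 0 0] by simp
  note [simp] = poly_scale_pCons[of f, OF f0]
  have add: "poly_scale f (q + r) x = poly_scale f q x + poly_scale f r x" for q r x
    by (induction q r rule: poly_induct2) (simp_all add: f_add algebra_simps)
  have smult: "poly_scale f (smult a q) x = a *s poly_scale f q x" for a q x
    by (induction q) (simp_all add: f_scale algebra_simps)
  show ?thesis
  proof
    show "poly_scale f q (x + y) = poly_scale f q x + poly_scale f q y" for q x y
      by (induction q) (simp_all add: f_add algebra_simps)
    show "poly_scale f q (poly_scale f r x) = poly_scale f (q * r) x" for q r x
      by (induction q) (simp_all add: add smult)
    show "poly_scale f 1 x = x" for x
      by (simp add: one_pCons f0)
  qed (rule add)
qed

text \<open>\<open>Z\<close> and \<open>B\<close> present the group \<open>H = Z / B\<close>. The denominators \<open>u\<close> express that \<open>S\<close> generates \<open>H\<close>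
  over the integers localized at \<open>p\<close> without that ring acting on \<open>Z\<close>.\<close>

context
  fixes Z B S :: "'b set" and p :: int and f :: "'b \<Rightarrow> 'b"
  assumes Z: "subspace Z" and B: "subspace B" "B \<subseteq> Z"
    and S: "finite S" "S \<subseteq> Z"
    and gen: "\<And>x. x \<in> Z \<Longrightarrow> \<exists>u w. coprime u p \<and> w \<in> span S \<and> u *s x - w \<in> B"
    and f_add: "\<And>x y. f (x + y) = f x + f y"
    and f_Z: "\<And>x. x \<in> Z \<Longrightarrow> f x \<in> Z" and f_B: "\<And>x. x \<in> B \<Longrightarrow> f x \<in> B"
begin

lemma f_scale: "f (c *s x) = c *s f x"
proof -
  interpret f: additive f by standard (rule f_add)
  show ?thesis
  proof (induction c rule: int_induct[where k = 0])
    case base then show ?case by (simp add: f.zero)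
  next
    case (step1 i) then show ?case by (simp add: scale_left_distrib f_add)
  next
    case (step2 i) then show ?case by (simp add: scale_left_diff_distrib f.diff)
  qed
qed

lemma f_diff: "f (x - y) = f x - f y"
  using f_add[of x "- y"] f_scale[of "-1" y] by simp

lemma funpow_f_diff: "(f ^^ n) (x - y) = (f ^^ n) x - (f ^^ n) y"
  by (induction n) (simp_all add: f_diff)

lemma funpow_f_Z: "x \<in> Z \<Longrightarrow> (f ^^ n) x \<in> Z"
  by (induction n) (simp_all add: f_Z)

text \<open>This is the finiteness of \<open>H / pH\<close>: the coefficient vectors come from the
  finite set \<open>S \<rightarrow>\<^sub>E {0..<p}\<close>.\<close>

lemma residue_representative:
  assumes "p > 0" "z \<in> Z"
  shows "\<exists>c \<in> S \<rightarrow>\<^sub>E {0..<p}. \<exists>y\<in>Z. z - (\<Sum>s\<in>S. c s *s s) - p *s y \<in> B"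
proof -
  obtain u w where u: "coprime u p" "w \<in> span S" "u *s z - w \<in> B" using gen assms by blast
  obtain a where w: "w = (\<Sum>s\<in>S. a s *s s)" using u S by (auto simp: span_finite)
  \<comment> \<open>\<open>v\<close> inverts \<open>u\<close> modulo \<open>p\<close>, so modulo
    \<open>B\<close> the element \<open>z\<close> agrees with \<open>v *s w\<close> up to a multiple
    of \<open>p\<close>.\<close>
  obtain v k where vk: "v * u + k * p = 1"
    using u(1) bezout_int[of u p] by (auto simp: coprime_iff_gcd_eq_1)
  \<comment> \<open>All multiples of \<open>p\<close> are collected here: the quotients of the
    coefficients and the Bezout term \<open>k *s z\<close>.\<close>
  define y where "y = (\<Sum>s\<in>S. ((v * a s) div p) *s s) + k *s z"
  have "y \<in> Z" unfolding y_def using S assms Z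
    by (intro subspace_add[OF Z] subspace_sum[OF Z] subspace_scale[OF Z]) auto
  have "z = (v * u + k * p) *s z" using vk by simp
  then have z: "z = v *s u *s z + p *s k *s z" by (simp add: algebra_simps)
  have "v *s w = (\<Sum>s\<in>S. (v * a s) *s s)" unfolding w by (simp add: scale_sum_right)
  also have "\<dots> = (\<Sum>s\<in>S. ((v * a s) mod p) *s s + p *s ((v * a s) div p) *s s)"
    unfolding scale_scale scale_left_distrib[symmetric] mod_mult_div_eq ..
  also have "\<dots> = (\<Sum>s\<in>S. ((v * a s) mod p) *s s) + p *s (\<Sum>s\<in>S. ((v * a s) div p) *s s)"
    by (simp only: sum.distrib scale_sum_right)
  finally have vw: "v *s w = (\<Sum>s\<in>S. ((v * a s) mod p) *s s)
      + p *s (\<Sum>s\<in>S. ((v * a s) div p) *s s)" .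
  have "z - (\<Sum>s\<in>S. ((v * a s) mod p) *s s) - p *s y = v *s (u *s z - w)"
    unfolding scale_right_diff_distrib vw y_def scale_right_distrib by (subst (1) z) simp
  also have "\<dots> \<in> B" using u B by (simp add: subspace_scale)
  finally have "z - (\<Sum>s\<in>S. restrict (\<lambda>s. (v * a s) mod p) S s *s s) - p *s y \<in> B" by simp
  moreover have "restrict (\<lambda>s. (v * a s) mod p) S \<in> S \<rightarrow>\<^sub>E {0..<p}" using assms by auto
  ultimately show ?thesis using \<open>y \<in> Z\<close> by blast
qed

text \<open>\<open>H / pH\<close> is finite, so two iterates of \<open>x\<close> agree there; injectivity of \<open>f\<close> on \<open>H / pH\<close> cancels
  the common power.\<close>

lemma surj_mod_p:
  assumes "p > 0"
    and inj: "\<And>x y. x \<in> Z \<Longrightarrow> y \<in> Z \<Longrightarrow> f x - p *s y \<in> B \<Longrightarrow> \<exists>y'\<in>Z. x - p *s y' \<in> B"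
    and x: "x \<in> Z"
  shows "\<exists>y\<in>Z. \<exists>y'\<in>Z. x - f y - p *s y' \<in> B"
proof -
  have "\<forall>n. \<exists>c. c \<in> S \<rightarrow>\<^sub>E {0..<p} \<and> (\<exists>y\<in>Z. (f ^^ n) x - (\<Sum>s\<in>S. c s *s s) - p *s y \<in> B)"
    using residue_representative[OF \<open>p > 0\<close> funpow_f_Z[OF x]] by blast
  then obtain c where c: "\<And>n. c n \<in> S \<rightarrow>\<^sub>E {0..<p}"
      "\<And>n. \<exists>y\<in>Z. (f ^^ n) x - (\<Sum>s\<in>S. c n s *s s) - p *s y \<in> B"
    by metis
  have "finite (range c)"
    by (rule finite_subset[of _ "S \<rightarrow>\<^sub>E {0..<p}"]) (use c S in \<open>auto intro: finite_PiE\<close>)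
  then have "\<not> inj c" using finite_imageD infinite_UNIV_nat by blast
  then obtain i j where "i < j" "c i = c j" unfolding inj_def by (metis linorder_neqE_nat)
  \<comment> \<open>The difference of the exponents is written \<open>Suc d\<close> so that one
    \<open>f\<close> can be split off: \<open>(f ^^ d) x\<close> will be the preimage of
    \<open>x\<close> modulo \<open>p\<close>.\<close>
  then obtain d where j: "j = i + Suc d" by (metis less_natE add_Suc_right)
  have fj: "(f ^^ i) ((f ^^ Suc d) x) = (f ^^ j) x" by (simp only: j funpow_add comp_apply)
  obtain y y' where y: "y \<in> Z" "y' \<in> Z" "(f ^^ i) x - (\<Sum>s\<in>S. c i s *s s) - p *s y \<in> B"
      "(f ^^ j) x - (\<Sum>s\<in>S. c i s *s s) - p *s y' \<in> B"
    using c(2)[of i] c(2)[of j] \<open>c i = c j\<close> by auto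
  let ?x = "x - (f ^^ Suc d) x"
  have "(f ^^ i) ?x - p *s (y - y')
      = ((f ^^ i) x - (\<Sum>s\<in>S. c i s *s s) - p *s y) - ((f ^^ j) x - (\<Sum>s\<in>S. c i s *s s) - p *s y')"
    unfolding funpow_f_diff fj by (simp add: scale_right_diff_distrib)
  also have "\<dots> \<in> B" using y B subspace_diff by blast
  finally have "\<exists>y\<in>Z. (f ^^ i) ?x - p *s y \<in> B" using y Z subspace_diff by blast
  moreover have "\<exists>y\<in>Z. z - p *s y \<in> B" if "z \<in> Z" "\<exists>y\<in>Z. (f ^^ n) z - p *s y \<in> B" for n z
    using that(2)
  proof (induction n)
    case (Suc n)
    then show ?case using inj[of "(f ^^ n) z"] funpow_f_Z[OF that(1), of n] by auto
  qed simp
  moreover have "?x \<in> Z" by (intro subspace_diff[OF Z] x funpow_f_Z)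
  ultimately obtain w where "w \<in> Z" "x - f ((f ^^ d) x) - p *s w \<in> B" by auto
  then show ?thesis using funpow_f_Z[OF x] by blast
qed

text \<open>\<open>div_inj\<close> and \<open>div_surj\<close> stand for the module structure of
  \<open>H\<close> over the localization. They turn the multiples that Nakayama's lemma delivers
  back into the elements themselves.\<close>

proposition endomorphism_bijective:
  assumes p: "prime p"
    and div_inj: "\<And>u x. coprime u p \<Longrightarrow> x \<in> Z \<Longrightarrow> u *s x \<in> B \<Longrightarrow> x \<in> B"
    and div_surj: "\<And>u x. coprime u p \<Longrightarrow> x \<in> Z \<Longrightarrow> \<exists>y\<in>Z. x - u *s y \<in> B"
    and inj: "\<And>x y. x \<in> Z \<Longrightarrow> y \<in> Z \<Longrightarrow> f x - p *s y \<in> B \<Longrightarrow> \<exists>y'\<in>Z. x - p *s y' \<in> B"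
  shows "\<And>x. x \<in> Z \<Longrightarrow> \<exists>y\<in>Z. x - f y \<in> B"
    and "\<And>x. x \<in> Z \<Longrightarrow> f x \<in> B \<Longrightarrow> x \<in> B"
proof -
  have p0: "p > 0" using p prime_gt_0_int by blast
  have unit_diff: "coprime (v - p * r) p" if "coprime v p" for v r
  proof -
    have "v - p * r = - r * p + v" by simp
    then show ?thesis using that by (metis coprime_iff_gcd_eq_1 gcd.commute gcd_add_mult)
  qed
  \<comment> \<open>The preimage in \<open>Z\<close> of the image of \<open>f\<close> on
    \<open>H\<close>.\<close>
  define N where "N = {f y + b | y b. y \<in> Z \<and> b \<in> B}"
  have N: "subspace N"
  proof (rule subspaceI)
    show "0 \<in> N" unfolding N_def using Z B f_scale[of 0 0]
      by (auto intro!: exI[of _ 0] simp: subspace_0)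
    show "x + y \<in> N" if "x \<in> N" "y \<in> N" for x y
    proof -
      obtain a b c d where "x = f a + b" "a \<in> Z" "b \<in> B" "y = f c + d" "c \<in> Z" "d \<in> B"
        using \<open>x \<in> N\<close> \<open>y \<in> N\<close> N_def by auto
      moreover from this have "x + y = f (a + c) + (b + d)" by (simp add: f_add)
      ultimately show ?thesis unfolding N_def using Z B subspace_add by blast
    qed
    show "c *s x \<in> N" if "x \<in> N" for c x
    proof -
      obtain a b where "x = f a + b" "a \<in> Z" "b \<in> B"
        using \<open>x \<in> N\<close> N_def by auto
      moreover from this have "c *s x = f (c *s a) + c *s b" by (simp add: f_scale scale_right_distrib)
      ultimately show ?thesis unfolding N_def using Z B subspace_scale by blast
    qed
  qed
  have NZ: "N \<subseteq> Z" unfolding N_def using f_Z B Z subspace_add by blast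
  have surj_p: "\<exists>y\<in>Z. \<exists>y'\<in>Z. x - f y - p *s y' \<in> B" if x: "x \<in> Z" for x
    by (rule surj_mod_p[OF p0 _ x]) (rule inj)
  have surj: "\<exists>y\<in>Z. x - f y \<in> B" if x: "x \<in> Z" for x
  proof -
    have "\<exists>v\<in>{v. coprime v p}. v *s x \<in> N"
    proof (rule nakayama_multiplicative[OF S Z N NZ, where i = p])
      show "\<exists>v\<in>{v. coprime v p}. \<exists>n\<in>N. \<exists>w\<in>span S. v *s m = n + p *s w" if m: "m \<in> Z" for m
      proof -
        obtain y y' where y: "y \<in> Z" "y' \<in> Z" "m - f y - p *s y' \<in> B"
          using surj_p[OF m] by blast
        obtain u w where u: "coprime u p" "w \<in> span S" "u *s y' - w \<in> B" using gen y by blast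
        \<comment> \<open>Modulo \<open>B\<close>, \<open>m\<close> is \<open>f y + p *s y'\<close>
          and \<open>u *s y'\<close> is \<open>w\<close>; multiplying \<open>m\<close> by
          \<open>u\<close> moves the last term into \<open>p\<close> times
          \<open>span S\<close>.\<close>
        have "u *s m - p *s w = f (u *s y) + (u *s (m - f y - p *s y') + p *s (u *s y' - w))"
          by (simp add: f_scale algebra_simps)
        moreover have "u *s (m - f y - p *s y') + p *s (u *s y' - w) \<in> B"
          using y u B by (simp add: subspace_add subspace_scale)
        moreover have "u *s y \<in> Z" using y Z subspace_scale by blast
        ultimately have "u *s m - p *s w \<in> N" unfolding N_def by blast
        then show ?thesis using u by (metis diff_add_cancel mem_Collect_eq)
      qed
      show "v * w \<in> {v. coprime v p}" if "v \<in> {v. coprime v p}" "w \<in> {v. coprime v p}" for v w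
        using that by simp
      show "v - p * r \<in> {v. coprime v p}" if "v \<in> {v. coprime v p}" for v r
        using that unit_diff by simp
    qed (rule x)
    then obtain v where v: "coprime v p" "v *s x \<in> N" by blast
    obtain y b where y: "y \<in> Z" "b \<in> B" "v *s x = f y + b" using v N_def by auto
    \<comment> \<open>Dividing \<open>y\<close> by \<open>v\<close> in \<open>H\<close> makes
      \<open>v *s (x - f y')\<close> lie in \<open>B\<close>, and \<open>v\<close> can then be
      cancelled.\<close>
    obtain y' where y': "y' \<in> Z" "y - v *s y' \<in> B" using div_surj[OF v(1) y(1)] by blast
    have "v *s (x - f y') = f (y - v *s y') + b"
      using y by (simp add: f_scale f_diff algebra_simps)
    also have "\<dots> \<in> B" using y y' f_B B subspace_add by blast
    finally have "x - f y' \<in> B"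
      using div_inj v x y' f_Z Z subspace_diff by blast
    then show ?thesis using y' by blast
  qed
  then show "\<exists>y\<in>Z. x - f y \<in> B" if "x \<in> Z" for x using that by blast

  text \<open>A surjective endomorphism of a finitely generated module is injective: apply the same lemma
    over \<open>\<int>[x]\<close>, where \<open>x\<close> acts as \<open>f\<close>, to \<open>H = x H\<close>.\<close>
  interpret P: Modules.module "poly_scale f"
    by (rule module_poly_scale) (simp_all add: f_add f_scale)
  have f0: "f 0 = 0" using f_scale[of 0 0] by simp
  note pCons = poly_scale_pCons[of f, OF f0]
  have P_closed: "poly_scale f q x \<in> A" if "subspace A" "\<And>x. x \<in> A \<Longrightarrow> f x \<in> A" "x \<in> A" for q x A
    using that by (induction q) (simp_all add: pCons subspace_0 subspace_add subspace_scale)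
  have P_subspace: "P.subspace A" if "subspace A" "\<And>x. x \<in> A \<Longrightarrow> f x \<in> A" for A
    using that P_closed[OF that] by (intro P.subspaceI) (simp_all add: subspace_0 subspace_add)
  have const: "poly_scale f [:a:] x = a *s x" for a x by (simp add: pCons f0)
  \<comment> \<open>The hypothesis \<open>gen\<close> speaks of integer combinations, while
    Nakayama's lemma now refers to the span over polynomials.\<close>
  have span_S: "span S \<subseteq> P.span S"
  proof (rule span_minimal[OF P.span_superset subspaceI])
    show "c *s x \<in> P.span S" if "x \<in> P.span S" for c x
      using P.span_scale[OF that, of "[:c:]"] by (simp add: const)
  qed (auto intro: P.span_zero P.span_add)
  show "x \<in> B" if x: "x \<in> Z" and fx: "f x \<in> B" for x
  proof -
    \<comment> \<open>Here \<open>B\<close> takes the place of \<open>N\<close>: some polynomial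
      with constant term coprime to \<open>p\<close> kills the class of \<open>x\<close>.
      Subtracting a multiple of the variable leaves the constant term unchanged.\<close>
    have "\<exists>v\<in>{q. coprime (coeff q 0) p}. poly_scale f v x \<in> B"
    proof (rule P.nakayama_multiplicative[OF S P_subspace[OF Z f_Z] P_subspace[OF B(1) f_B] B(2),
          where i = "[:0, 1:]"])
      show "\<exists>v\<in>{q. coprime (coeff q 0) p}. \<exists>n\<in>B. \<exists>w\<in>P.span S.
          poly_scale f v m = n + poly_scale f [:0, 1:] w" if m: "m \<in> Z" for m
      proof -
        obtain y where y: "y \<in> Z" "m - f y \<in> B" using surj m by blast
        obtain u w where u: "coprime u p" "w \<in> span S" "u *s y - w \<in> B" using gen y by blast
        have "u *s m = (u *s (m - f y) + f (u *s y - w)) + f w"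
          by (simp add: f_scale f_diff algebra_simps)
        moreover have "u *s (m - f y) + f (u *s y - w) \<in> B"
          using y u B f_B by (simp add: subspace_add subspace_scale)
        moreover have "poly_scale f [:0, 1:] w = f w" by (simp add: pCons f0)
        ultimately have "\<exists>n\<in>B. \<exists>w\<in>P.span S. poly_scale f [:u:] m = n + poly_scale f [:0, 1:] w"
          using u(2) span_S unfolding const by (metis subsetD)
        then show ?thesis using u(1) by (intro bexI[of _ "[:u:]"]) simp_all
      qed
      show "v * w \<in> {q. coprime (coeff q 0) p}"
        if "v \<in> {q. coprime (coeff q 0) p}" "w \<in> {q. coprime (coeff q 0) p}" for v w
        using that by (simp add: coeff_mult)
      show "v - [:0, 1:] * r \<in> {q. coprime (coeff q 0) p}" if "v \<in> {q. coprime (coeff q 0) p}" for v r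
        using that by (simp add: coeff_mult)
    qed (simp_all add: x)
    then obtain v where v: "coprime (coeff v 0) p" "poly_scale f v x \<in> B" by blast
    \<comment> \<open>Split off the constant term \<open>a\<close>. As \<open>f x\<close> vanishes
      in \<open>H\<close>, the rest of the polynomial kills the class of \<open>x\<close>; so
      \<open>a\<close> does too, and \<open>a\<close> is coprime to \<open>p\<close>.\<close>
    obtain a q where q: "v = pCons a q" by (cases v)
    have "f (poly_scale f q x) = poly_scale f q (f x)" for x
      by (induction q arbitrary: x) (simp_all add: pCons f0 f_add f_scale)
    then have "a *s x = poly_scale f v x - poly_scale f q (f x)" by (simp add: q pCons)
    also have "\<dots> \<in> B" using v(2) P_closed[OF B(1) f_B fx] B subspace_diff by blast
    finally show ?thesis using div_inj v(1) x q by simp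
  qed
qed

end

end

section \<open>Finitely generated modules over the integers localized at \<open>p\<close>\<close>

lemma int_module_frag_cmul: "int_module (frag_cmul :: int \<Rightarrow> ('a \<Rightarrow>\<^sub>0 int) \<Rightarrow> ('a \<Rightarrow>\<^sub>0 int))"
  by standard (simp_all add: frag_cmul_distrib frag_cmul_distrib2)

interpretation frag: int_module "frag_cmul :: int \<Rightarrow> ('a \<Rightarrow>\<^sub>0 int) \<Rightarrow> ('a \<Rightarrow>\<^sub>0 int)"
  by (rule int_module_frag_cmul)

declare frag.scale_minus_left [simp del]

lemma Z_loc_simps [simp]:
  "add (Z_loc p) = (+)" "monoid.mult (Z_loc p) = (*)" "\<zero>\<^bsub>Z_loc p\<^esub> = 0" "\<one>\<^bsub>Z_loc p\<^esub> = 1"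
  by (simp_all add: Z_loc_def)

lemma module_of_simps [simp]:
  "carrier (module_of G act) = carrier G" "add (module_of G act) = monoid.mult G"
  "\<zero>\<^bsub>module_of G act\<^esub> = \<one>\<^bsub>G\<^esub>" "Module.smult (module_of G act) = act"
  by (simp_all add: module_of_def)

lemma frac_in_Z_loc:
  assumes "prime p" "coprime b (int p)"
  shows "of_int a / of_int b \<in> carrier (Z_loc p)"
proof -
  have "\<not> int p dvd b" using assms coprime_absorb_right[of "int p" b]
    by (metis coprime_absorb_right int_ops(2) not_prime_unit of_nat_eq_iff prime_nat_int_transfer)
  then show ?thesis by (auto simp: Z_loc_def)
qed

lemma Z_loc_cases:
  assumes "prime p" "r \<in> carrier (Z_loc p)"
  obtains a b where "coprime b (int p)" "of_int b * r = of_int a"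
proof -
  obtain a b :: int where ab: "\<not> int p dvd b" "r = of_int a / of_int b"
    using assms(2) by (auto simp: Z_loc_def)
  have "prime (int p)" using assms by simp
  then have "coprime b (int p)" using ab(1) prime_imp_coprime coprime_commute by blast
  moreover have "of_int b * r = of_int a" using ab by (cases "b = 0") simp_all
  ultimately show ?thesis using that by blast
qed

text \<open>The module action exists on classes only. The conclusions express it through integer
  multiples of representatives, in the form that \<open>endomorphism_bijective\<close>
  requires.\<close>

lemma fin_gen_over_Z_loc_presentation:
  fixes G :: "('g, 'b) monoid_scheme" and cls :: "('a \<Rightarrow>\<^sub>0 int) \<Rightarrow> 'g"
  assumes p: "prime p" and fg: "fin_gen_over_Z_loc p G"
    and Z: "frag.subspace Z" and B: "frag.subspace B"
    and carrier: "carrier G = cls ` Z" and one: "\<one>\<^bsub>G\<^esub> = cls 0"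
    and mult: "\<And>a b. a \<in> Z \<Longrightarrow> b \<in> Z \<Longrightarrow> cls a \<otimes>\<^bsub>G\<^esub> cls b = cls (a + b)"
    and eq: "\<And>a b. cls a = cls b \<longleftrightarrow> a - b \<in> B"
  obtains S where "finite S" "S \<subseteq> Z"
    and "\<And>x. x \<in> Z \<Longrightarrow>
      \<exists>u w. coprime u (int p) \<and> w \<in> frag.span S \<and> frag_cmul u x - w \<in> B"
    and "\<And>u x. coprime u (int p) \<Longrightarrow> x \<in> Z \<Longrightarrow> frag_cmul u x \<in> B \<Longrightarrow> x \<in> B"
    and "\<And>u x. coprime u (int p) \<Longrightarrow> x \<in> Z \<Longrightarrow> \<exists>y\<in>Z. x - frag_cmul u y \<in> B"
proof -
  obtain act where "fin_gen_module (Z_loc p) (module_of G act)"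
    using fg fin_gen_over_Z_loc_def by blast
  then obtain T where mod: "Module.module (Z_loc p) (module_of G act)" and T: "finite T" "T \<subseteq> carrier G"
    and T_gen: "\<And>x. x \<in> carrier G \<Longrightarrow> \<exists>c \<in> T \<rightarrow> carrier (Z_loc p).
      x = finsum (module_of G act) (\<lambda>s. act (c s) s) T"
    by (auto simp: fin_gen_module_def)
  interpret M: Module.module "Z_loc p" "module_of G act" by (rule mod)
  have int: "of_int k \<in> carrier (Z_loc p)" for k
    using frac_in_Z_loc[OF p, of 1 k] by simp
  \<comment> \<open>The action is known through the module axioms only; additivity in the scalar
    determines it on integers, by induction in both directions.\<close>
  have act_int: "act (of_int k) (cls z) = cls (frag_cmul k z)" if z: "z \<in> Z" for k z
  proof -
    have cz: "cls z \<in> carrier G" using z carrier by simp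
    have step: "act (of_int (k + 1)) (cls z) = act (of_int k) (cls z) \<otimes>\<^bsub>G\<^esub> cls z" for k
      using M.smult_l_distr[OF int[of k] int[of 1], of "cls z"] M.smult_one[of "cls z"] cz by simp
    have step': "cls (frag_cmul (k + 1) z) = cls (frag_cmul k z) \<otimes>\<^bsub>G\<^esub> cls z" for k
      using z mult[of "frag_cmul k z" z] frag.subspace_scale[OF Z z, of k]
      by (simp add: frag_cmul_distrib)
    show ?thesis
    proof (induction k rule: int_induct[where k = 0])
      case base
      show ?case using M.smult_l_null[of "cls z"] cz one by simp
    next
      case (step1 i)
      then show ?case using step step' by simp
    next
      case (step2 i)
      have "act (of_int (i - 1)) (cls z) \<otimes>\<^bsub>G\<^esub> cls z = cls (frag_cmul (i - 1) z) \<otimes>\<^bsub>G\<^esub> cls z"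
        using step[of "i - 1"] step'[of "i - 1"] step2 by simp
      moreover have "act (of_int (i - 1)) (cls z) \<in> carrier G"
        using M.smult_closed[OF int[of "i - 1"], of "cls z"] cz by simp
      moreover have "cls (frag_cmul (i - 1) z) \<in> carrier G"
        using frag.subspace_scale[OF Z z] carrier by blast
      ultimately show ?case
        using M.add.right_cancel[of "cls z"] cz by simp
    qed
  qed
  have inverse: "act (of_int u) (act (1 / of_int u) x) = x \<and> act (1 / of_int u) (act (of_int u) x) = x"
    if "coprime u (int p)" "x \<in> carrier G" for u x
  proof -
    have "u \<noteq> 0" using that p by (auto simp: prime_gt_1_nat)
    moreover have "1 / of_int u \<in> carrier (Z_loc p)" using frac_in_Z_loc[OF p that(1), of 1] by simp
    ultimately show ?thesis
      using M.smult_assoc1[of "of_int u" "1 / of_int u" x] M.smult_assoc1[of "1 / of_int u" "of_int u" x]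
        M.smult_one[of x] that int by simp
  qed
  have inj: "x \<in> B" if "coprime u (int p)" "x \<in> Z" "frag_cmul u x \<in> B" for u x
  proof -
    have "1 / of_int u \<in> carrier (Z_loc p)" using frac_in_Z_loc[OF p that(1), of 1] by simp
    moreover have "act (of_int u) (cls x) = \<one>\<^bsub>G\<^esub>"
      using that eq[of "frag_cmul u x" 0] one act_int by simp
    ultimately have "cls x = \<one>\<^bsub>G\<^esub>"
      using inverse[OF that(1), of "cls x"] that(2) carrier M.smult_r_null[of "1 / of_int u"] by simp
    then show ?thesis using eq[of x 0] one by simp
  qed
  have surj: "\<exists>y\<in>Z. x - frag_cmul u y \<in> B" if "coprime u (int p)" "x \<in> Z" for u x
  proof -
    have "1 / of_int u \<in> carrier (Z_loc p)" using frac_in_Z_loc[OF p that(1), of 1] by simp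
    then have "act (1 / of_int u) (cls x) \<in> carrier G"
      using M.smult_closed[of "1 / of_int u" "cls x"] that(2) carrier by simp
    then obtain y where y: "y \<in> Z" "act (1 / of_int u) (cls x) = cls y" using carrier by auto
    have "cls x = cls (frag_cmul u y)"
      using inverse[OF that(1), of "cls x"] that(2) carrier y act_int by simp
    then show ?thesis using y eq by blast
  qed
  define rep where "rep = (\<lambda>s. SOME z. z \<in> Z \<and> cls z = s)"
  have rep: "rep s \<in> Z \<and> cls (rep s) = s" if "s \<in> carrier G" for s
    unfolding rep_def by (rule someI_ex) (use that carrier in auto)
  define S where "S = rep ` T"
  \<comment> \<open>The classes generated by \<open>S\<close> up to a denominator. They include
    \<open>T\<close> and are closed under sums and scalars, hence exhaust \<open>G\<close>.\<close>
  define K where "K = {cls z | z u w. z \<in> Z \<and> coprime u (int p) \<and> w \<in> frag.span S \<and> frag_cmul u z - w \<in> B}"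
  have K_carrier: "K \<subseteq> carrier G" unfolding K_def using carrier by auto
  have K_one: "\<one>\<^bsub>G\<^esub> \<in> K"
    unfolding K_def one using frag.subspace_0[OF Z] frag.subspace_0[OF B] frag.span_zero[of S]
    by (intro CollectI exI[of _ 0] exI[of _ "1::int"]) simp
  have K_rep: "s \<in> K" if "s \<in> T" for s
  proof -
    have "rep s \<in> frag.span S" unfolding S_def using that by (intro frag.span_base) simp
    then show ?thesis unfolding K_def using rep[of s] that T frag.subspace_0[OF B]
      by (intro CollectI exI[of _ "rep s"] exI[of _ "1::int"]) auto
  qed
  have K_mult: "x \<otimes>\<^bsub>G\<^esub> y \<in> K" if "x \<in> K" "y \<in> K" for x y
  proof -
    obtain z u w where z: "x = cls z" "z \<in> Z" "coprime u (int p)" "w \<in> frag.span S" "frag_cmul u z - w \<in> B"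
      using \<open>x \<in> K\<close> K_def by blast
    obtain z' u' w' where z': "y = cls z'" "z' \<in> Z" "coprime u' (int p)" "w' \<in> frag.span S"
        "frag_cmul u' z' - w' \<in> B"
      using \<open>y \<in> K\<close> K_def by blast
    let ?w = "frag_cmul u' w + frag_cmul u w'"
    have "frag_cmul (u * u') (z + z') - ?w
        = frag_cmul u' (frag_cmul u z - w) + frag_cmul u (frag_cmul u' z' - w')"
      by (simp add: frag_cmul_distrib2 frag.scale_right_diff_distrib mult.commute)
    also have "\<dots> \<in> B" using z z' B frag.subspace_add frag.subspace_scale by blast
    finally have "frag_cmul (u * u') (z + z') - ?w \<in> B" .
    moreover have "?w \<in> frag.span S" using z z' frag.span_add frag.span_scale by blast
    moreover have "coprime (u * u') (int p)" using z z' by simp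
    moreover have "x \<otimes>\<^bsub>G\<^esub> y = cls (z + z')" "z + z' \<in> Z"
      using z z' mult frag.subspace_add[OF Z] by auto
    ultimately show ?thesis unfolding K_def by blast
  qed
  have K_act: "act r x \<in> K" if r: "r \<in> carrier (Z_loc p)" and x: "x \<in> K" for r x
  proof -
    obtain z u w where z: "x = cls z" "z \<in> Z" "coprime u (int p)" "w \<in> frag.span S" "frag_cmul u z - w \<in> B"
      using \<open>x \<in> K\<close> K_def by blast
    \<comment> \<open>The scalar \<open>r\<close> is \<open>a / b\<close>, so a representative
      \<open>z'\<close> of \<open>act r x\<close> satisfies \<open>b z' = a z\<close> modulo
      \<open>B\<close>, and \<open>u * b\<close> is a denominator for it.\<close>
    obtain a b where ab: "coprime b (int p)" "of_int b * r = of_int a"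
      using Z_loc_cases[OF p r] .
    have "act r x \<in> carrier G" using M.smult_closed[OF r, of x] x K_carrier by auto
    then obtain z' where z': "act r x = cls z'" "z' \<in> Z" using carrier by auto
    have "cls (frag_cmul b z') = cls (frag_cmul a z)"
      using M.smult_assoc1[OF int[of b] r, of x] ab z z' carrier act_int by simp
    then have "frag_cmul b z' - frag_cmul a z \<in> B" using eq by simp
    moreover have "frag_cmul (u * b) z' - frag_cmul a w
        = frag_cmul u (frag_cmul b z' - frag_cmul a z) + frag_cmul a (frag_cmul u z - w)"
      by (simp add: frag.scale_right_diff_distrib mult.commute)
    ultimately have "frag_cmul (u * b) z' - frag_cmul a w \<in> B"
      using z B frag.subspace_add frag.subspace_scale by metis
    moreover have "frag_cmul a w \<in> frag.span S" "coprime (u * b) (int p)"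
      using z ab frag.span_scale by auto
    ultimately show ?thesis unfolding K_def using z' by blast
  qed
  have "finsum (module_of G act) (\<lambda>s. act (c s) s) T' \<in> K"
    if "finite T'" "T' \<subseteq> T" "c \<in> T \<rightarrow> carrier (Z_loc p)" for c T'
    using that(1,2)
  proof (induction T')
    case empty
    then show ?case using K_one by simp
  next
    case (insert s T')
    then have s: "act (c s) s \<in> K" using that(3) K_act K_rep by auto
    have "(\<lambda>s. act (c s) s) \<in> T' \<rightarrow> carrier (module_of G act)"
      using insert that(3) subsetD[OF K_carrier K_act[OF _ K_rep]] by auto
    then show ?case
      using M.finsum_insert[of T' s "\<lambda>s. act (c s) s"] insert s K_mult K_carrier by auto
  qed
  then have "carrier G \<subseteq> K" using T_gen T by force
  then have "\<exists>u w. coprime u (int p) \<and> w \<in> frag.span S \<and> frag_cmul u x - w \<in> B" if "x \<in> Z" for x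
  proof -
    have "cls x \<in> K" using that \<open>carrier G \<subseteq> K\<close> carrier by auto
    then obtain z u w where z: "cls x = cls z" "z \<in> Z" "coprime u (int p)" "w \<in> frag.span S"
        "frag_cmul u z - w \<in> B"
      using K_def by auto
    \<comment> \<open>Membership in \<open>K\<close> provides some representative \<open>z\<close>
      of the class of \<open>x\<close>; the difference \<open>x - z\<close> lies in
      \<open>B\<close>.\<close>
    have "frag_cmul u x - w = frag_cmul u (x - z) + (frag_cmul u z - w)"
      by (simp add: frag.scale_right_diff_distrib)
    also have "\<dots> \<in> B" using z eq B frag.subspace_add frag.subspace_scale by blast
    finally show ?thesis using z by blast
  qed
  moreover have "finite S" "S \<subseteq> Z" unfolding S_def using T rep by auto
  ultimately show thesis using that inj surj by blast
qed

section \<open>Induced maps in homology on the level of cycles\<close>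

text \<open>Bijectivity of the map induced by \<open>F\<close> on \<open>Z / B\<close>, phrased on
  representatives so that the quotient is never formed.\<close>

definition bij_mod :: "('a::ab_group_add \<Rightarrow> 'a) \<Rightarrow> 'a set \<Rightarrow> 'a set \<Rightarrow> bool" where
  "bij_mod F Z B \<longleftrightarrow> (\<forall>x\<in>Z. F x \<in> B \<longrightarrow> x \<in> B) \<and> (\<forall>x\<in>Z. \<exists>y\<in>Z. x - F y \<in> B)"

text \<open>Integral and mod \<open>m\<close> homology encode classes as sets of chains in different
  ways. An abstract \<open>cls\<close> covers both, and the universal coefficient argument can stay
  with chains.\<close>

lemma bij_betw_classes_iff:
  assumes h: "\<And>c. c \<in> Z \<Longrightarrow> h (cls c) = cls (F c)"
    and F: "F \<in> Z \<rightarrow> Z" "\<And>a b. F (a - b) = F a - F b"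
    and cls: "\<And>a b. cls a = cls b \<longleftrightarrow> a - b \<in> B"
    and Z: "0 \<in> Z" "\<And>a b. a \<in> Z \<Longrightarrow> b \<in> Z \<Longrightarrow> a - b \<in> Z"
  shows "bij_betw h (cls ` Z) (cls ` Z) \<longleftrightarrow> bij_mod F Z B"
proof -
  have F0: "F 0 = 0" using F(2)[of 0 0] by simp
  have "inj_on h (cls ` Z) \<longleftrightarrow> (\<forall>x\<in>Z. F x \<in> B \<longrightarrow> x \<in> B)"
  proof
    assume inj: "inj_on h (cls ` Z)"
    show "\<forall>x\<in>Z. F x \<in> B \<longrightarrow> x \<in> B"
    proof (intro ballI impI)
      fix x assume x: "x \<in> Z" "F x \<in> B"
      have "h (cls x) = h (cls 0)" using x Z h F0 cls by simp
      then have "cls x = cls 0" using inj_onD[OF inj] x Z by blast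
      then show "x \<in> B" using cls by simp
    qed
  next
    assume *: "\<forall>x\<in>Z. F x \<in> B \<longrightarrow> x \<in> B"
    show "inj_on h (cls ` Z)"
    proof (rule inj_onI, clarify)
      fix x y assume xy: "x \<in> Z" "y \<in> Z" "h (cls x) = h (cls y)"
      then have "F (x - y) \<in> B" using h cls F(2) by simp
      then show "cls x = cls y" using xy * Z cls by blast
    qed
  qed
  moreover have "h ` cls ` Z = cls ` Z \<longleftrightarrow> (\<forall>x\<in>Z. \<exists>y\<in>Z. x - F y \<in> B)"
  proof -
    have "h ` cls ` Z \<subseteq> cls ` Z" using h F(1) by auto
    moreover have "cls ` Z \<subseteq> h ` cls ` Z \<longleftrightarrow> (\<forall>x\<in>Z. \<exists>y\<in>Z. x - F y \<in> B)"
      unfolding image_image image_subset_iff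
      using h cls by (auto simp: image_iff)
    ultimately show ?thesis by blast
  qed
  ultimately show ?thesis by (simp add: bij_betw_def bij_mod_def)
qed

section \<open>Integral homology on cycles\<close>

lemma subspace_singular_relcycle: "frag.subspace (singular_relcycle_set i X S)"
  by (rule frag.subspaceI) (auto intro: singular_relcycle_add singular_relcycle_cmul)

lemma subspace_singular_relboundary: "frag.subspace (singular_relboundary_set i X S)"
  by (rule frag.subspaceI) (auto intro: singular_relboundary_add singular_relboundary_cmul)

lemma homologous_rel_set_mult:
  "homologous_rel_set i X S a \<otimes>\<^bsub>relative_homology_group (int i) X S\<^esub> homologous_rel_set i X S b
    = homologous_rel_set i X S (a + b)"
proof -
  have "\<exists>r s. homologous_rel i X S a r \<and> homologous_rel i X S b s \<and> x = r + s"
    if "homologous_rel i X S (a + b) x" for x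
  proof (intro exI conjI)
    show "homologous_rel i X S b (x - a)"
      using that by (simp add: homologous_rel_def algebra_simps)
  qed auto
  then show ?thesis
    unfolding mult_relative_homology_group by (auto intro: homologous_rel_add)
qed

lemma reduced_homology_iso_iff:
  assumes f: "continuous_map X X f" and i: "i \<noteq> 0"
  shows "hom_induced (int i) X {} X {} f \<in> iso (reduced_homology_group (int i) X) (reduced_homology_group (int i) X)
    \<longleftrightarrow> bij_mod (chain_map i f) (singular_relcycle_set i X {}) (singular_relboundary_set i X {})"
proof -
  have "bij_betw (hom_induced (int i) X {} X {} f)
      (homologous_rel_set i X {} ` singular_relcycle_set i X {})
      (homologous_rel_set i X {} ` singular_relcycle_set i X {})
    \<longleftrightarrow> bij_mod (chain_map i f) (singular_relcycle_set i X {}) (singular_relboundary_set i X {})"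
  proof (rule bij_betw_classes_iff)
    show "hom_induced (int i) X {} X {} f (homologous_rel_set i X {} c)
        = homologous_rel_set i X {} (chain_map i f c)" if "c \<in> singular_relcycle_set i X {}" for c
      using that f by (simp add: hom_induced_chain_map)
    show "homologous_rel_set i X {} a = homologous_rel_set i X {} b \<longleftrightarrow> a - b \<in> singular_relboundary_set i X {}" for a b
      unfolding homologous_rel_set_eq by (simp add: homologous_rel_def)
  qed (use f in \<open>auto simp: chain_map_diff singular_relcycle_diff singular_relcycle_chain_map\<close>)
  then show ?thesis
    using i by (simp add: iso_def un_reduced_homology_group hom_induced_empty_hom
        carrier_relative_homology_group)
qed

section \<open>Homology modulo \<open>m\<close> on cycles\<close>

lemma subspace_chain_subgroup:
  assumes "subgroup H (chain_group i X)"
  shows "frag.subspace H"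
proof (rule frag.subspaceI)
  interpret H: subgroup H "chain_group i X" by (rule assms)
  show "0 \<in> H" using H.one_closed by simp
  show "x + y \<in> H" if "x \<in> H" "y \<in> H" for x y using H.m_closed[OF that] by simp
  show "frag_cmul k x \<in> H" if x: "x \<in> H" for k x
  proof -
    have "x [^]\<^bsub>chain_group i X\<^esub> k \<in> H"
      using group.subgroup_int_pow_closed[OF group_chain_group assms x] .
    moreover have "Poly_Mapping.keys x \<subseteq> singular_simplex_set i X"
      using subsetD[OF H.subset x] by (simp add: singular_chain_def)
    ultimately show ?thesis by (simp add: chain_group_def int_pow_free_Abelian_group)
  qed
qed

lemma mod_boundaries_coset_eq_iff:
  "{a + c | c. c \<in> mod_boundaries m i X} = {b + c | c. c \<in> mod_boundaries m i X}
    \<longleftrightarrow> a - b \<in> mod_boundaries m i X"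
proof -
  note B = subspace_chain_subgroup[OF subgroup_mod_boundaries[of m i X]]
  note add = frag.subspace_add[OF B] and neg = frag.subspace_neg[OF B] and zero = frag.subspace_0[OF B]
  show ?thesis
  proof
    assume "{a + c | c. c \<in> mod_boundaries m i X} = {b + c | c. c \<in> mod_boundaries m i X}"
    moreover have "a \<in> {a + c | c. c \<in> mod_boundaries m i X}" using zero by force
    ultimately obtain c where "a = b + c" "c \<in> mod_boundaries m i X" by blast
    then show "a - b \<in> mod_boundaries m i X" by simp
  next
    assume ab: "a - b \<in> mod_boundaries m i X"
    have "a + c = b + ((a - b) + c)" "b + c = a + (- (a - b) + c)" for c by simp_all
    then show "{a + c | c. c \<in> mod_boundaries m i X} = {b + c | c. c \<in> mod_boundaries m i X}"
      using add[OF ab] add[OF neg[OF ab]] by blast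
  qed
qed

lemma carrier_mod_homology_group:
  "carrier (mod_homology_group m i X) = (\<lambda>c. {c + b | b. b \<in> mod_boundaries m i X}) ` mod_cycles m i X"
proof -
  have "carrier (subgroup_generated (chain_group i X) (mod_cycles m i X)) = mod_cycles m i X"
    by (simp add: subgroup.carrier_subgroup_generated_subgroup subgroup_mod_cycles)
  moreover have "mod_boundaries m i X #>\<^bsub>subgroup_generated (chain_group i X) (mod_cycles m i X)\<^esub> c
      = {c + b | b. b \<in> mod_boundaries m i X}" for c
    by (auto simp: r_coset_def add.commute)
  ultimately show ?thesis by (simp add: mod_homology_group_def carrier_FactGroup)
qed

lemma mod_homology_group_mult:
  "{a + c | c. c \<in> mod_boundaries m i X} \<otimes>\<^bsub>mod_homology_group m i X\<^esub> {b + c | c. c \<in> mod_boundaries m i X}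
    = {a + b + c | c. c \<in> mod_boundaries m i X}"
proof -
  note B = subspace_chain_subgroup[OF subgroup_mod_boundaries[of m i X]]
  have "(\<Union>x\<in>{a + c | c. c \<in> mod_boundaries m i X}. \<Union>y\<in>{b + c | c. c \<in> mod_boundaries m i X}. {x + y})
    = {a + b + c | c. c \<in> mod_boundaries m i X}" (is "?L = ?R")
  proof
    show "?L \<subseteq> ?R"
    proof
      fix x assume "x \<in> ?L"
      then obtain c d where cd: "c \<in> mod_boundaries m i X" "d \<in> mod_boundaries m i X"
          "x = a + b + (c + d)"
        by (auto simp: algebra_simps)
      then show "x \<in> ?R" using frag.subspace_add[OF B] by blast
    qed
    show "?R \<subseteq> ?L"
    proof clarify
      fix c assume "c \<in> mod_boundaries m i X"
      then show "a + b + c \<in> ?L"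
        using frag.subspace_0[OF B]
        by (intro UN_I[of "a + c"] UN_I[of "b + 0"]) (auto simp: algebra_simps)
    qed
  qed
  then show ?thesis by (simp add: mod_homology_group_def set_mult_def)
qed

lemma one_mod_homology_group: "\<one>\<^bsub>mod_homology_group m i X\<^esub> = mod_boundaries m i X"
  by (simp add: mod_homology_group_def)

lemma chain_map_mod_cycles:
  assumes f: "continuous_map X Y f" and c: "c \<in> mod_cycles m i X"
  shows "chain_map i f c \<in> mod_cycles m i Y"
  using c chain_map_chain_multiples[OF _ f, of "chain_boundary i c" m "i - 1"]
  by (auto simp: mod_cycles_def chain_boundary_chain_map singular_chain_chain_map[OF _ f])

lemma mod_hom_induced_hom:
  assumes f: "continuous_map X Y f"
  shows "mod_hom_induced m i X Y f \<in> hom (mod_homology_group m i X) (mod_homology_group m i Y)"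
proof (rule homI)
  fix A B assume A: "A \<in> carrier (mod_homology_group m i X)" and B: "B \<in> carrier (mod_homology_group m i X)"
  then show "mod_hom_induced m i X Y f A \<in> carrier (mod_homology_group m i Y)"
    using chain_map_mod_cycles[OF f]
    by (auto simp: carrier_mod_homology_group mod_hom_induced_class[OF f])
  obtain a b where "A = {a + c | c. c \<in> mod_boundaries m i X}" "B = {b + c | c. c \<in> mod_boundaries m i X}"
    using A B unfolding carrier_mod_homology_group by blast
  then show "mod_hom_induced m i X Y f (A \<otimes>\<^bsub>mod_homology_group m i X\<^esub> B)
      = mod_hom_induced m i X Y f A \<otimes>\<^bsub>mod_homology_group m i Y\<^esub> mod_hom_induced m i X Y f B"
    by (simp only: mod_homology_group_mult mod_hom_induced_class[OF f] chain_map_add)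
qed

lemma frag_cmul_of_nat_cancel: "m \<noteq> 0 \<Longrightarrow> frag_cmul (int m) x = frag_cmul (int m) y \<longleftrightarrow> x = y"
  by (metis eq_iff_diff_eq_0 frag.scale_right_diff_distrib frag_cmul_eq_0_iff of_nat_eq_0_iff)

text \<open>If \<open>c\<close> has boundary \<open>m e\<close>, then \<open>e\<close> is a cycle
  because chains are torsion-free. It bounds some \<open>d\<close>, and \<open>c - m d\<close> is an
  integral cycle, hence a boundary.\<close>

lemma trivial_mod_homology_singleton:
  assumes "topspace X = {a}" "i \<noteq> 0" "m \<noteq> 0"
  shows "mod_cycles m i X = mod_boundaries m i X"
proof (rule subset_antisym[OF _ mod_boundaries_subset_cycles], rule subsetI)
  fix c assume "c \<in> mod_cycles m i X"
  then obtain e where c: "singular_chain i X c" and e: "singular_chain (i - 1) X e"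
      "chain_boundary i c = frag_cmul (int m) e"
    by (auto simp: mod_cycles_def chain_multiples_def)
  have "frag_cmul (int m) (chain_boundary (i - 1) e) = 0"
    using chain_boundary_boundary[OF c] e by (simp flip: chain_boundary_cmul)
  then have ce: "singular_relcycle (i - 1) X {} e" using e assms(3) by (simp add: singular_cycle)
  obtain d where d: "singular_chain i X d" "chain_boundary i d = e"
  \<comment> \<open>Not every \<open>0\<close>-cycle of a point bounds, but boundaries of
    \<open>1\<close>-chains there vanish, so \<open>e = 0\<close> when \<open>i = 1\<close>.\<close>
  proof (cases "i = 1")
    case True
    then have "e = 0" using chain_boundary_of_singleton[OF assms(1) c] e assms(3) by simp
    then show ?thesis using that[of 0] by simp
  next
    case False
    then have "singular_relboundary (i - 1) X {} e"
      using singular_boundary_eq_cycle_singleton[OF assms(1)] ce assms(2) by simp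
    then show ?thesis using that assms(2) by (auto simp: singular_boundary)
  qed
  have "singular_relcycle i X {} (c - frag_cmul (int m) d)"
    using c d e by (simp add: singular_cycle chain_boundary_diff chain_boundary_cmul singular_chain_diff singular_chain_cmul)
  then have "singular_relboundary i X {} (c - frag_cmul (int m) d)"
    using singular_boundary_eq_cycle_singleton[OF assms(1)] assms(2) by simp
  then obtain g where "singular_chain (Suc i) X g" "c = chain_boundary (Suc i) g + frag_cmul (int m) d"
    by (auto simp: singular_boundary algebra_simps)
  then show "c \<in> mod_boundaries m i X"
    using d by (auto simp: mod_boundaries_def chain_multiples_def)
qed

lemma un_reduced_mod_homology_group:
  assumes "i \<noteq> 0" "m \<noteq> 0"
  shows "reduced_mod_homology_group m i X = mod_homology_group m i X"
proof -
  let ?P = "discrete_topology {()}"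
  have "carrier (mod_homology_group m i ?P) = {\<one>\<^bsub>mod_homology_group m i ?P\<^esub>}"
  proof -
    have "A = \<one>\<^bsub>mod_homology_group m i ?P\<^esub>" if A: "A \<in> carrier (mod_homology_group m i ?P)" for A
    proof -
      obtain c where "c \<in> mod_boundaries m i ?P" "A = {c + b | b. b \<in> mod_boundaries m i ?P}"
        using A trivial_mod_homology_singleton[of ?P "()" i m] assms
        unfolding carrier_mod_homology_group by auto
      then have "A = {0 + b | b. b \<in> mod_boundaries m i ?P}"
        using mod_boundaries_coset_eq_iff[of c m i ?P 0] by simp
      then show ?thesis by (simp add: one_mod_homology_group)
    qed
    then show ?thesis
      using group.is_monoid[OF group_mod_homology_group, THEN monoid.one_closed] by blast
  qed
  then have "kernel (mod_homology_group m i X) (mod_homology_group m i ?P)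
      (mod_hom_induced m i X ?P (\<lambda>x. ())) = carrier (mod_homology_group m i X)"
    using mod_hom_induced_hom[of X ?P "\<lambda>x. ()" m i] by (auto simp: kernel_def hom_def)
  then show ?thesis
    by (simp add: reduced_mod_homology_group_def group.subgroup_generated_group_carrier group_mod_homology_group)
qed

lemma reduced_mod_homology_iso_iff:
  assumes f: "continuous_map X X f" and "i \<noteq> 0" "m \<noteq> 0"
  shows "mod_hom_induced m i X X f \<in> iso (reduced_mod_homology_group m i X) (reduced_mod_homology_group m i X)
    \<longleftrightarrow> bij_mod (chain_map i f) (mod_cycles m i X) (mod_boundaries m i X)"
proof -
  note Z = subspace_chain_subgroup[OF subgroup_mod_cycles[of m i X]]
  have "bij_betw (mod_hom_induced m i X X f)
      (carrier (mod_homology_group m i X)) (carrier (mod_homology_group m i X))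
    \<longleftrightarrow> bij_mod (chain_map i f) (mod_cycles m i X) (mod_boundaries m i X)"
    unfolding carrier_mod_homology_group
    by (intro bij_betw_classes_iff)
      (auto simp: mod_hom_induced_class[OF f] chain_map_diff mod_boundaries_coset_eq_iff
        intro: chain_map_mod_cycles[OF f] frag.subspace_0[OF Z] frag.subspace_diff[OF Z])
  then show ?thesis
    using assms by (simp add: iso_def un_reduced_mod_homology_group mod_hom_induced_hom)
qed

section \<open>Universal coefficients and self-closeness numbers\<close>

lemma mod_boundariesI:
  assumes "singular_chain (Suc i) X d" "singular_chain i X e"
    and "c = chain_boundary (Suc i) d + frag_cmul (int m) e"
  shows "c \<in> mod_boundaries m i X"
  using assms by (auto simp: mod_boundaries_def chain_multiples_def)

section \<open>Degree zero\<close>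

lemma singular_chain_0_path_connected:
  assumes X: "path_connected_space X" and \<sigma>: "singular_simplex 0 X \<sigma>" and c: "singular_chain 0 X c"
  shows "\<exists>n. singular_relboundary 0 X {} (c - frag_cmul n (frag_of \<sigma>))"
  using c unfolding singular_chain_def
proof (induction c rule: frag_induction)
  case zero
  show ?case by (rule exI[of _ 0]) simp
next
  case (one \<tau>)
  then show ?case
    using iso_integer_zeroth_homology_group_aux[OF X _ \<sigma>, of \<tau>]
    by (intro exI[of _ 1]) (simp add: homologous_rel_def)
next
  case (diff a b)
  then obtain k l where "singular_relboundary 0 X {} (a - frag_cmul k (frag_of \<sigma>))"
      "singular_relboundary 0 X {} (b - frag_cmul l (frag_of \<sigma>))"
    by blast
  then have "singular_relboundary 0 X {} ((a - frag_cmul k (frag_of \<sigma>)) - (b - frag_cmul l (frag_of \<sigma>)))"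
    by (rule singular_relboundary_diff)
  then show ?case
    by (intro exI[of _ "k - l"]) (simp add: frag_cmul_diff_distrib algebra_simps)
qed

lemma chain_map_singular_boundary_0:
  assumes "singular_relboundary 0 X {} c"
  shows "chain_map 0 (\<lambda>_. ()) c = 0"
proof -
  have "singular_relboundary 0 (discrete_topology {()}) {} (chain_map 0 (\<lambda>_. ()) c)"
    using assms by (rule singular_relboundary_chain_map) auto
  then show ?thesis
    using singular_boundary_singleton[of "discrete_topology {()}" "()" 0] by simp
qed

lemma obtain_singular_simplex_0:
  assumes "topspace X \<noteq> {}"
  obtains \<sigma> where "singular_simplex 0 X \<sigma>"
proof -
  obtain a where "a \<in> topspace X" using assms by blast
  then have "singular_simplex 0 X (restrict (\<lambda>_. a) (standard_simplex 0))"
    by (simp add: singular_simplex_def)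
  then show thesis by (rule that)
qed

text \<open>The chain map to a point is the augmentation.\<close>

lemma chain_map_point_0_multiple:
  assumes "path_connected_space X" "topspace X \<noteq> {}" "singular_chain 0 X c"
    and "chain_map 0 (\<lambda>_. ()) c = frag_cmul (int m) e"
  shows "\<exists>c'. singular_chain 0 X c' \<and> singular_relboundary 0 X {} (c - frag_cmul (int m) c')
    \<and> (e = 0 \<longrightarrow> c' = 0)"
proof -
  obtain \<sigma> where \<sigma>: "singular_simplex 0 X \<sigma>" using obtain_singular_simplex_0 assms(2) .
  obtain n where n: "singular_relboundary 0 X {} (c - frag_cmul n (frag_of \<sigma>))"
    using singular_chain_0_path_connected[OF assms(1) \<sigma> assms(3)] by blast
  let ?s = "simplex_map 0 (\<lambda>_. ()) \<sigma>"
  have "frag_cmul (int m) e = frag_cmul n (frag_of ?s)"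
    using chain_map_singular_boundary_0[OF n] assms(4) by (simp add: chain_map_diff)
  \<comment> \<open>Comparing coefficients at the simplex \<open>?s\<close> shows that
    \<open>m\<close> divides \<open>n\<close>; the quotient, which is zero for \<open>e = 0\<close>,
    is the coefficient of \<open>c'\<close>.\<close>
  then have "int m * Poly_Mapping.lookup e ?s = n"
    by (metis frag_of_nonzero lookup_frag_cmul lookup_frag_of mult.right_neutral)
  then show ?thesis
    using n \<sigma> by (intro exI[of _ "frag_cmul (Poly_Mapping.lookup e ?s) (frag_of \<sigma>)"])
      (auto simp: singular_chain_cmul singular_chain_of)
qed

lemma trivial_reduced_homology_group_0:
  assumes "path_connected_space X" "topspace X \<noteq> {}"
  shows "trivial_group (reduced_homology_group 0 X)"
proof -
  have "A = \<one>\<^bsub>reduced_homology_group 0 X\<^esub>" if A: "A \<in> carrier (reduced_homology_group 0 X)" for A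
  proof -
    let ?P = "discrete_topology {()}"
    have AH: "A \<in> carrier (homology_group 0 X)"
      and A1: "hom_induced 0 X {} ?P {} (\<lambda>_. ()) A = \<one>\<^bsub>homology_group 0 ?P\<^esub>"
      using A by (auto simp: carrier_reduced_homology_group kernel_def)
    obtain c where c: "singular_relcycle 0 X {} c" "A = homologous_rel_set 0 X {} c"
      using AH carrier_relative_homology_group[of 0 X "{}"] by auto
    have "homologous_rel_set 0 ?P {} (chain_map 0 (\<lambda>_. ()) c) = singular_relboundary_set 0 ?P {}"
      using A1 c hom_induced_chain_map[of X ?P "\<lambda>_. ()" "{}" "{}" 0 c]
        one_relative_homology_group[of 0 ?P "{}"] by simp
    then have "singular_relboundary 0 ?P {} (chain_map 0 (\<lambda>_. ()) c)"
      by (simp only: homologous_rel_set_eq_relboundary)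
    \<comment> \<open>Brought into the form with \<open>m = 1\<close> and \<open>e = 0\<close>,
      where the witness \<open>c'\<close> is \<open>0\<close> and so \<open>c\<close> itself
      bounds.\<close>
    then have "chain_map 0 (\<lambda>_. ()) c = frag_cmul (int 1) 0"
      using singular_boundary_singleton[of ?P "()" 0] by simp
    then have "singular_relboundary 0 X {} c"
      using chain_map_point_0_multiple[OF assms, of c 1 0] c by (auto simp: singular_cycle)
    then show ?thesis
      using c homologous_rel_set_eq_relboundary[of 0 X "{}" c] one_relative_homology_group[of 0 X "{}"]
      by (simp add: one_reduced_homology_group)
  qed
  then show ?thesis
    using group.is_monoid[OF group_reduced_homology_group, THEN monoid.one_closed]
    by (auto simp: trivial_group_def)
qed

lemma trivial_reduced_mod_homology_group_0:
  assumes "path_connected_space X" "topspace X \<noteq> {}"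
  shows "trivial_group (reduced_mod_homology_group m 0 X)"
proof -
  let ?P = "discrete_topology {()}"
  have "A = \<one>\<^bsub>mod_homology_group m 0 X\<^esub>"
    if A: "A \<in> carrier (mod_homology_group m 0 X)"
      and A1: "mod_hom_induced m 0 X ?P (\<lambda>_. ()) A = \<one>\<^bsub>mod_homology_group m 0 ?P\<^esub>" for A
  proof -
    obtain c where c: "singular_chain 0 X c" "A = {c + b | b. b \<in> mod_boundaries m 0 X}"
      using A by (auto simp: carrier_mod_homology_group mod_cycles_def)
    have "{chain_map 0 (\<lambda>_. ()) c + b | b. b \<in> mod_boundaries m 0 ?P} = {0 + b | b. b \<in> mod_boundaries m 0 ?P}"
      using A1 mod_hom_induced_class[of X ?P "\<lambda>_. ()" m 0 c] c by (simp add: one_mod_homology_group)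
    then have "chain_map 0 (\<lambda>_. ()) c \<in> mod_boundaries m 0 ?P"
      unfolding mod_boundaries_coset_eq_iff by simp
    then obtain d e where de: "singular_chain (Suc 0) ?P d"
        "chain_map 0 (\<lambda>_. ()) c = chain_boundary (Suc 0) d + frag_cmul (int m) e"
      by (auto simp: mod_boundaries_def chain_multiples_def)
    \<comment> \<open>Boundaries of \<open>1\<close>-chains in a point vanish, so the augmentation
      of \<open>c\<close> is a multiple of \<open>m\<close>.\<close>
    have "chain_map 0 (\<lambda>_. ()) c = frag_cmul (int m) e"
      using de chain_boundary_of_singleton[of ?P "()" "Suc 0" d] by simp
    then obtain c' where c': "singular_chain 0 X c'" "singular_relboundary 0 X {} (c - frag_cmul (int m) c')"
      using chain_map_point_0_multiple[OF assms c(1)] by blast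
    obtain g where "singular_chain (Suc 0) X g" "chain_boundary (Suc 0) g = c - frag_cmul (int m) c'"
      using c'(2) by (auto simp: singular_boundary)
    then have "c = chain_boundary (Suc 0) g + frag_cmul (int m) c'" by simp
    then have "c \<in> mod_boundaries m 0 X"
      using c' \<open>singular_chain (Suc 0) X g\<close> by (auto simp: mod_boundaries_def chain_multiples_def)
    then have "A = {0 + b | b. b \<in> mod_boundaries m 0 X}"
      unfolding c(2) mod_boundaries_coset_eq_iff by simp
    then show ?thesis by (simp add: one_mod_homology_group)
  qed
  then have "kernel (mod_homology_group m 0 X) (mod_homology_group m 0 ?P) (mod_hom_induced m 0 X ?P (\<lambda>_. ()))
      \<subseteq> {\<one>\<^bsub>mod_homology_group m 0 X\<^esub>}"
    by (auto simp: kernel_def)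
  then show ?thesis
    unfolding reduced_mod_homology_group_def
    by (rule group.trivial_group_subgroup_generated[OF group_mod_homology_group])
qed

lemma iso_trivial_group:
  assumes "trivial_group G" "h \<one>\<^bsub>G\<^esub> = \<one>\<^bsub>G\<^esub>"
  shows "h \<in> iso G G"
  using assms group.is_monoid[of G] monoid.l_one[of G "\<one>\<^bsub>G\<^esub>"]
  by (auto simp: trivial_group_def iso_def hom_def bij_betw_def)

text \<open>The augmentation has torsion-free values, and its kernel consists of boundaries. This
  settles the torsion of \<open>H_0\<close>, about which reduced homology in degree zero gives no
  information.\<close>

lemma zeroth_torsion_free:
  assumes "path_connected_space X" "topspace X \<noteq> {}" "m \<noteq> 0" "singular_chain 0 X e"
    and "singular_relboundary 0 X {} (frag_cmul (int m) e)"
  shows "singular_relboundary 0 X {} e"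
proof -
  have "frag_cmul (int m) (chain_map 0 (\<lambda>_. ()) e) = 0"
    using chain_map_singular_boundary_0[OF assms(5)] by simp
  then have "chain_map 0 (\<lambda>_. ()) e = frag_cmul (int 1) 0" using assms(3) by simp
  then show ?thesis using chain_map_point_0_multiple[OF assms(1,2,4), of 1 0] by auto
qed

text \<open>The naturality and five lemma part of the universal coefficient theorem: besides bijectivity on
  \<open>H\<^sub>i\<close> only bijectivity on the \<open>m\<close>-torsion of \<open>H\<^sub>j\<close>, \<open>j = i - 1\<close>, is used.\<close>

lemma bij_mod_cycles:
  assumes f: "continuous_map X X f" and m: "m \<noteq> 0" and i: "i = Suc j"
    and bij: "bij_mod (chain_map i f) (singular_relcycle_set i X {}) (singular_relboundary_set i X {})"
    and tors_inj: "\<And>e. \<lbrakk>singular_relcycle j X {} e; singular_relboundary j X {} (frag_cmul (int m) e);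
      singular_relboundary j X {} (chain_map j f e)\<rbrakk> \<Longrightarrow> singular_relboundary j X {} e"
    and tors_surj: "\<And>e. \<lbrakk>singular_relcycle j X {} e; singular_relboundary j X {} (frag_cmul (int m) e)\<rbrakk> \<Longrightarrow>
      \<exists>e'. singular_relcycle j X {} e' \<and> singular_relboundary j X {} (frag_cmul (int m) e')
        \<and> singular_relboundary j X {} (e - chain_map j f e')"
  shows "bij_mod (chain_map i f) (mod_cycles m i X) (mod_boundaries m i X)"
proof -
  have bd: "singular_relboundary j X {} x \<longleftrightarrow> (\<exists>d. singular_chain i X d \<and> chain_boundary i d = x)" for x
    by (simp add: singular_boundary i)
  have cancel: "x = 0" if "frag_cmul (int m) x = 0" for x :: "'a chain" using that m by simp
  \<comment> \<open>The class of \<open>e\<close> is the Bockstein image of \<open>c\<close>, an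
    \<open>m\<close>-torsion class in \<open>H_j\<close>.\<close>
  have cycle: "\<exists>e. singular_relcycle j X {} e \<and> chain_boundary i c = frag_cmul (int m) e"
    if c: "c \<in> mod_cycles m i X" for c
  proof -
    obtain e where e: "singular_chain i X c" "singular_chain j X e" "chain_boundary i c = frag_cmul (int m) e"
      using c by (auto simp: mod_cycles_def chain_multiples_def i)
    have "frag_cmul (int m) (chain_boundary j e) = 0"
      using chain_boundary_boundary[OF e(1)] e(3) i by (simp flip: chain_boundary_cmul)
    then show ?thesis using e cancel by (auto simp: singular_cycle)
  qed
  show ?thesis
    unfolding bij_mod_def
  proof (intro conjI ballI impI)
    fix c assume c: "c \<in> mod_cycles m i X" "chain_map i f c \<in> mod_boundaries m i X"
    have cc: "singular_chain i X c" using c by (simp add: mod_cycles_def)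
    obtain e where e: "singular_relcycle j X {} e" "chain_boundary i c = frag_cmul (int m) e"
      using cycle c by blast
    obtain d g where dg: "singular_chain (Suc i) X d" "singular_chain i X g"
        "chain_map i f c = chain_boundary (Suc i) d + frag_cmul (int m) g"
      using c by (auto simp: mod_boundaries_def chain_multiples_def)
    have "chain_boundary i (chain_map i f c) = frag_cmul (int m) (chain_map j f e)"
      using chain_boundary_chain_map[OF cc, of f] e i by simp
    moreover have "chain_boundary i (chain_map i f c) = frag_cmul (int m) (chain_boundary i g)"
      using dg by (simp add: chain_boundary_add chain_boundary_cmul chain_boundary_boundary_alt)
    ultimately have fe: "chain_map j f e = chain_boundary i g" using m by (simp add: frag_cmul_of_nat_cancel)
    have "singular_relboundary j X {} e"
      using tors_inj[OF e(1)] bd fe cc e(2) dg(2) by metis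
    then obtain h where h: "singular_chain i X h" "chain_boundary i h = e" using bd by blast
    \<comment> \<open>An integral cycle that differs from \<open>c\<close> by a multiple of
      \<open>m\<close>.\<close>
    define x where "x = c - frag_cmul (int m) h"
    have x: "singular_relcycle i X {} x"
      using cc h e by (simp add: x_def singular_cycle singular_chain_diff singular_chain_cmul
          chain_boundary_diff chain_boundary_cmul)
    have "singular_relcycle i X {} (g - chain_map i f h)"
      using dg h fe chain_boundary_chain_map[OF h(1), of f] i singular_chain_chain_map[OF h(1) f]
      by (simp add: singular_cycle singular_chain_diff chain_boundary_diff)
    \<comment> \<open>Surjectivity on \<open>H_i\<close> supplies the correction of \<open>x\<close>
      by \<open>m z\<close> after which its image bounds; injectivity on \<open>H_i\<close> then
      applies.\<close>
    then obtain z where z: "singular_relcycle i X {} z"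
        "singular_relboundary i X {} (g - chain_map i f h - chain_map i f z)"
      using bij unfolding bij_mod_def by auto
    let ?y = "x - frag_cmul (int m) z"
    have "chain_map i f ?y = chain_boundary (Suc i) d + frag_cmul (int m) (g - chain_map i f h - chain_map i f z)"
      using dg by (simp add: x_def chain_map_diff frag.scale_right_diff_distrib)
    moreover have "singular_relboundary i X {} (chain_boundary (Suc i) d)"
      using dg by (auto simp: singular_boundary)
    ultimately have "singular_relboundary i X {} (chain_map i f ?y)"
      using z by (simp add: singular_relboundary_add singular_relboundary_cmul)
    then have "singular_relboundary i X {} ?y"
      using bij x z(1) unfolding bij_mod_def by (auto intro: singular_relcycle_diff singular_relcycle_cmul)
    then obtain d' where d': "singular_chain (Suc i) X d'" "chain_boundary (Suc i) d' = ?y"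
      by (auto simp: singular_boundary)
    then have "c = chain_boundary (Suc i) d' + frag_cmul (int m) (h + z)"
      by (simp add: x_def frag_cmul_distrib2)
    moreover have "singular_chain i X (h + z)" using h z by (simp add: singular_cycle singular_chain_add)
    ultimately show "c \<in> mod_boundaries m i X"
      using d' by (auto intro: mod_boundariesI)
  next
    fix c' assume c': "c' \<in> mod_cycles m i X"
    then have cc': "singular_chain i X c'" by (simp add: mod_cycles_def)
    obtain e' where e': "singular_relcycle j X {} e'" "chain_boundary i c' = frag_cmul (int m) e'"
      using cycle c' by blast
    have "singular_relboundary j X {} (frag_cmul (int m) e')" using bd cc' e' by metis
    then obtain e where e: "singular_relcycle j X {} e" "singular_relboundary j X {} (frag_cmul (int m) e)"
        "singular_relboundary j X {} (e' - chain_map j f e)"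
      using tors_surj e'(1) by blast
    obtain c where c: "singular_chain i X c" "chain_boundary i c = frag_cmul (int m) e" using e bd by blast
    obtain w where w: "singular_chain i X w" "chain_boundary i w = e' - chain_map j f e" using e bd by blast
    have cm: "c \<in> mod_cycles m i X"
      using c e i by (auto simp: mod_cycles_def chain_multiples_def singular_cycle)
    \<comment> \<open>The boundary is \<open>m e' - m f e - m (e' - f e) = 0\<close>, so
      surjectivity on \<open>H_i\<close> applies to \<open>y\<close>.\<close>
    define y where "y = c' - chain_map i f c - frag_cmul (int m) w"
    have "singular_relcycle i X {} y"
      using cc' c w e' chain_boundary_chain_map[OF c(1), of f] i singular_chain_chain_map[OF c(1) f]
      by (simp add: y_def singular_cycle singular_chain_diff singular_chain_cmul chain_boundary_diff
          chain_boundary_cmul frag.scale_right_diff_distrib)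
    then obtain z where z: "singular_relcycle i X {} z" "singular_relboundary i X {} (y - chain_map i f z)"
      using bij unfolding bij_mod_def by auto
    obtain u where u: "singular_chain (Suc i) X u" "chain_boundary (Suc i) u = y - chain_map i f z"
      using z by (auto simp: singular_boundary)
    have "c' - chain_map i f (c + z) = chain_boundary (Suc i) u + frag_cmul (int m) w"
      by (simp add: u y_def chain_map_add)
    then have "c' - chain_map i f (c + z) \<in> mod_boundaries m i X"
      using u w by (auto intro: mod_boundariesI)
    moreover have "z \<in> mod_cycles m i X"
      using z zero_chain_multiples by (auto simp: mod_cycles_def singular_cycle)
    then have "c + z \<in> mod_cycles m i X"
      using cm frag.subspace_add[OF subspace_chain_subgroup[OF subgroup_mod_cycles]] by blast
    ultimately show "\<exists>y\<in>mod_cycles m i X. c' - chain_map i f y \<in> mod_boundaries m i X" by blast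
  qed
qed

text \<open>\<open>H / pH\<close> embeds into mod \<open>p\<close> homology, compatibly with
  \<open>f\<close>. Injectivity there thus yields the hypothesis \<open>inj\<close> of
  \<open>endomorphism_bijective\<close>.\<close>

lemma bij_mod_relcycles:
  assumes f: "continuous_map X X f" and p: "prime p"
    and fg: "fin_gen_over_Z_loc p (homology_group (int i) X)"
    and bij: "bij_mod (chain_map i f) (mod_cycles p i X) (mod_boundaries p i X)"
  shows "bij_mod (chain_map i f) (singular_relcycle_set i X {}) (singular_relboundary_set i X {})"
proof -
  let ?Z = "singular_relcycle_set i X {}" and ?B = "singular_relboundary_set i X {}"
  have eq: "homologous_rel_set i X {} a = homologous_rel_set i X {} b \<longleftrightarrow> a - b \<in> ?B" for a b
    unfolding homologous_rel_set_eq by (simp add: homologous_rel_def)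
  have one: "\<one>\<^bsub>homology_group (int i) X\<^esub> = homologous_rel_set i X {} 0"
    using homologous_rel_set_eq_relboundary[of i X "{}" 0] by simp
  obtain S where S: "finite S" "S \<subseteq> ?Z"
    and gen: "\<And>x. x \<in> ?Z \<Longrightarrow> \<exists>u w. coprime u (int p) \<and> w \<in> frag.span S \<and> frag_cmul u x - w \<in> ?B"
    and div: "\<And>u x. coprime u (int p) \<Longrightarrow> x \<in> ?Z \<Longrightarrow> frag_cmul u x \<in> ?B \<Longrightarrow> x \<in> ?B"
      "\<And>u x. coprime u (int p) \<Longrightarrow> x \<in> ?Z \<Longrightarrow> \<exists>y\<in>?Z. x - frag_cmul u y \<in> ?B"
    by (rule fin_gen_over_Z_loc_presentation[OF p fg subspace_singular_relcycle
          subspace_singular_relboundary carrier_relative_homology_group one homologous_rel_set_mult eq]) blast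
  have BZ: "?B \<subseteq> ?Z" by (auto intro: singular_relboundary_imp_relcycle)
  have fZ: "chain_map i f x \<in> ?Z" if "x \<in> ?Z" for x
    using that f by (auto intro: singular_relcycle_chain_map)
  have fB: "chain_map i f x \<in> ?B" if "x \<in> ?B" for x
    using that f by (auto intro: singular_relboundary_chain_map)
  have inj: "\<exists>y'\<in>?Z. x - frag_cmul (int p) y' \<in> ?B"
    if x: "x \<in> ?Z" and y: "y \<in> ?Z" and xy: "chain_map i f x - frag_cmul (int p) y \<in> ?B" for x y
  proof -
    obtain d where d: "singular_chain (Suc i) X d" "chain_boundary (Suc i) d = chain_map i f x - frag_cmul (int p) y"
      using xy by (auto simp: singular_boundary)
    have "chain_map i f x = chain_boundary (Suc i) d + frag_cmul (int p) y" using d by simp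
    then have "chain_map i f x \<in> mod_boundaries p i X"
      using d y by (auto simp: singular_cycle intro: mod_boundariesI)
    moreover have "x \<in> mod_cycles p i X"
      using x zero_chain_multiples by (auto simp: mod_cycles_def singular_cycle)
    ultimately have "x \<in> mod_boundaries p i X" using bij by (simp add: bij_mod_def)
    then obtain d' g where g: "singular_chain (Suc i) X d'" "singular_chain i X g"
        "x = chain_boundary (Suc i) d' + frag_cmul (int p) g"
      by (auto simp: mod_boundaries_def chain_multiples_def)
    \<comment> \<open>Since \<open>x\<close> is a cycle and chains are torsion-free,
      \<open>g\<close> is a cycle too, so \<open>x\<close> is zero in \<open>H / pH\<close>.\<close>
    have "chain_boundary i x = frag_cmul (int p) (chain_boundary i g)"
      using g by (simp add: chain_boundary_add chain_boundary_cmul chain_boundary_boundary_alt)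
    then have "chain_boundary i g = 0" using x p by (auto simp: singular_cycle)
    then show ?thesis using g by (intro bexI[of _ g]) (auto simp: singular_cycle singular_boundary)
  qed
  have pp: "prime (int p)" using p by simp
  note endo = frag.endomorphism_bijective[OF subspace_singular_relcycle subspace_singular_relboundary BZ S]
  have "\<exists>y\<in>?Z. x - chain_map i f y \<in> ?B" if x: "x \<in> ?Z" for x
    by (rule endo(1)) (fact gen chain_map_add fZ fB pp div inj x)+
  moreover have "x \<in> ?B" if x: "x \<in> ?Z" "chain_map i f x \<in> ?B" for x
    by (rule endo(2)) (fact gen chain_map_add fZ fB pp div inj x)+
  ultimately show ?thesis by (simp add: bij_mod_def)
qed

proposition reduced_homology_iso_iff_mod:
  assumes f: "continuous_map X X f" and p: "prime p"
    and X: "path_connected_space X" "topspace X \<noteq> {}"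
    and fg: "\<And>i::nat. fin_gen_over_Z_loc p (reduced_homology_group (int i) X)"
  shows "(\<forall>i\<le>k. hom_induced (int i) X {} X {} f
            \<in> iso (reduced_homology_group (int i) X) (reduced_homology_group (int i) X))
    \<longleftrightarrow> (\<forall>i\<le>k. mod_hom_induced p i X X f
            \<in> iso (reduced_mod_homology_group p i X) (reduced_mod_homology_group p i X))"
    (is "(\<forall>i\<le>k. ?H i) \<longleftrightarrow> (\<forall>i\<le>k. ?M i)")
proof -
  have p0: "p \<noteq> 0" using p by auto
  have "?H 0"
  proof (rule iso_trivial_group)
    show "trivial_group (reduced_homology_group (int 0) X)"
      using trivial_reduced_homology_group_0[OF X] by simp
    show "hom_induced (int 0) X {} X {} f \<one>\<^bsub>reduced_homology_group (int 0) X\<^esub> = \<one>\<^bsub>reduced_homology_group (int 0) X\<^esub>"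
      using hom_induced_reduced_hom by (rule hom_one) simp_all
  qed
  have "?M 0"
  proof (rule iso_trivial_group)
    show "trivial_group (reduced_mod_homology_group p 0 X)"
      using trivial_reduced_mod_homology_group_0[OF X] by simp
    have "mod_hom_induced p 0 X X f \<one>\<^bsub>mod_homology_group p 0 X\<^esub> = \<one>\<^bsub>mod_homology_group p 0 X\<^esub>"
      using mod_hom_induced_hom[OF f] by (rule hom_one) (rule group_mod_homology_group)+
    then show "mod_hom_induced p 0 X X f \<one>\<^bsub>reduced_mod_homology_group p 0 X\<^esub> = \<one>\<^bsub>reduced_mod_homology_group p 0 X\<^esub>"
      by (simp add: reduced_mod_homology_group_def)
  qed
  have MH: "?H i" if "?M i" for i
  proof (cases "i = 0")
    case False
    then have "fin_gen_over_Z_loc p (homology_group (int i) X)"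
      using fg[of i] by (simp add: un_reduced_homology_group)
    then show ?thesis
      using that bij_mod_relcycles[OF f p] reduced_homology_iso_iff[OF f False]
        reduced_mod_homology_iso_iff[OF f False p0] by blast
  qed (use \<open>?H 0\<close> in simp)
  have HM: "?M (Suc j)" if H: "?H j" "?H (Suc j)" for j
  proof -
    have "bij_mod (chain_map (Suc j) f) (mod_cycles p (Suc j) X) (mod_boundaries p (Suc j) X)"
    proof (rule bij_mod_cycles[OF f p0 refl])
      show "bij_mod (chain_map (Suc j) f) (singular_relcycle_set (Suc j) X {}) (singular_relboundary_set (Suc j) X {})"
        using H(2) reduced_homology_iso_iff[OF f, of "Suc j"] by simp
    next
      fix e assume e: "singular_relcycle j X {} e" "singular_relboundary j X {} (frag_cmul (int p) e)"
      show "singular_relboundary j X {} e" if "singular_relboundary j X {} (chain_map j f e)"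
      proof (cases "j = 0")
        case True
        then show ?thesis using zeroth_torsion_free[OF X p0] e by (simp add: singular_cycle)
      next
        case False
        then show ?thesis using H(1) reduced_homology_iso_iff[OF f False] e that by (simp add: bij_mod_def)
      qed
      show "\<exists>e'. singular_relcycle j X {} e' \<and> singular_relboundary j X {} (frag_cmul (int p) e')
        \<and> singular_relboundary j X {} (e - chain_map j f e')"
      proof (cases "j = 0")
        case True
        then show ?thesis using zeroth_torsion_free[OF X p0] e by (intro exI[of _ 0]) (simp add: singular_cycle)
      next
        case False
        then have bij: "bij_mod (chain_map j f) (singular_relcycle_set j X {}) (singular_relboundary_set j X {})"
          using H(1) reduced_homology_iso_iff[OF f False] by simp
        then obtain e' where e': "singular_relcycle j X {} e'" "singular_relboundary j X {} (e - chain_map j f e')"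
          using e unfolding bij_mod_def by auto
        \<comment> \<open>The preimage \<open>e'\<close> is again \<open>p\<close>-torsion: the
          image of \<open>p e'\<close> agrees with \<open>p e\<close> up to a boundary, hence
          bounds, and \<open>f\<close> is injective on \<open>H_j\<close>.\<close>
        have "chain_map j f (frag_cmul (int p) e') = frag_cmul (int p) e - frag_cmul (int p) (e - chain_map j f e')"
          by (simp add: frag.scale_right_diff_distrib)
        then have "singular_relboundary j X {} (chain_map j f (frag_cmul (int p) e'))"
          using e(2) singular_relboundary_cmul[OF e'(2), of "int p"] singular_relboundary_diff by metis
        then have "singular_relboundary j X {} (frag_cmul (int p) e')"
          using bij singular_relcycle_cmul[OF e'(1)] by (simp add: bij_mod_def del: chain_map_cmul)
        then show ?thesis using e' by blast
      qed
    qed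
    then show ?thesis using reduced_mod_homology_iso_iff[OF f _ p0, of "Suc j"] by simp
  qed
  show ?thesis
  proof
    assume H: "\<forall>i\<le>k. ?H i"
    show "\<forall>i\<le>k. ?M i"
    proof (intro allI impI)
      fix i assume "i \<le> k"
      then show "?M i" using H HM \<open>?M 0\<close> by (metis Suc_leD not0_implies_Suc)
    qed
  qed (use MH in blast)
qed

theorem proposition3p7:
  fixes p :: nat and X :: "'a topology" and x0 :: 'a
  assumes "prime p"
    and "CW_complex X"
    and "x0 \<in> topspace X"
    and "simply_connected_space X"
    and "p_local_space p X"
    and "\<And>i::nat. fin_gen_over_Z_loc p (reduced_homology_group (int i) X)"
  shows "self_closeness X x0 = mod_self_closeness p X x0"
proof -
  have X: "path_connected_space X" "topspace X \<noteq> {}"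
    using assms(4) by (auto simp: simply_connected_space_def)
  \<comment> \<open>The isomorphism conditions range over all members of a class; these are
    continuous because a homotopy relates continuous maps.\<close>
  have "continuous_map X X f" if "F \<in> based_classes X x0" "f \<in> F" for F f
    using that by (auto simp: based_classes_def quotient_def based_homotopy_def
        dest: homotopic_with_imp_continuous_maps)
  then have "homology_iso_classes k X x0 = mod_homology_iso_classes p k X x0" for k
    unfolding homology_iso_classes_def mod_homology_iso_classes_def
    using reduced_homology_iso_iff_mod[OF _ assms(1) X assms(6), of _ k] by blast
  then show ?thesis by (simp add: self_closeness_def mod_self_closeness_def)
qed

end
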